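(* The derivability problem in $\mathbf{CommACT}_\omega$, that is, the set of all sequents derivable in the infinitary calculus $\mathbf{CommACT}_\omega$, belongs to the complexity class $\Pi_1^0$.
   Context: Formulae are built from a countable set of variables $\mathrm{Var}$ and constants $\mathbf{0},\mathbf{1}$ using binary connectives $\multimap,\cdot,\vee,\wedge$ and the unary connective ${}^*$. A sequent is an expression $\Gamma\vdash A$, where $\Gamma$ is a finite multiset of formulae (possibly empty) and $A$ is a formula. Sequents are encoded by natural numbers in a standard computable way. The calculus $\mathbf{CommACT}_\omega$ has the following axioms and rules. Axioms: $A\vdash A$; $\Gamma,\mathbf{0}\vdash C$; $\vdash\mathbf{1}$. Rules: ($\mathbf{1}L$) from $\Gamma\vdash C$ infer $\Gamma,\mathbf{1}\vdash C$; ($\multimap L$) from $\Pi\vdash A$ and $\Gamma,B\vdash C$ infer $\Gamma,\Pi,A\multimap B\vdash C$; ($\multimap R$) from $A,\Pi\vdash B$ infer $\Pi\vdash A\multimap B$; ($\cdot L$) from $\Gamma,A,B\vdash C$ infer $\Gamma,A\cdot B\vdash C$; ($\cdot R$) from $\Pi\vdash A$ and $\Delta\vdash B$ infer $\Pi,\Delta\vdash A\cdot B$; ($\vee L$) from $\Gamma,A\vdash C$ and $\Gamma,B\vdash C$ infer $\Gamma,A\vee B\vdash C$; ($\vee R$) from $\Pi\vdash A$ infer $\Pi\vdash A\vee B$; from $\Pi\vdash B$ infer $\Pi\vdash A\vee B$; ($\wedge L$) from $\Gamma,A\vdash C$ infer $\Gamma,A\wedge B\vdash C$; from $\Gamma,B\vdash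 C$ infer $\Gamma,A\wedge B\vdash C$; ($\wedge R$) from $\Pi\vdash A$ and $\Pi\vdash B$ infer $\Pi\vdash A\wedge B$; ($*L_\omega$) from the infinitely many premises $\Gamma,A^n\vdash C$ for all $n\ge 0$ infer $\Gamma,A^*\vdash C$, where $A^n$ in an antecedent means $n$ copies of $A$; ($*R_n$, $n\ge 0$) from $\Pi_1\vdash A,\ \ldots,\ \Pi_n\vdash A$ infer $\Pi_1,\ldots,\Pi_n\vdash A^*$ (for $n=0$: the axiom $\vdash A^*$); (Cut) from $\Pi\vdash A$ and $\Gamma,A\vdash C$ infer $\Gamma,\Pi\vdash C$. The set of derivable sequents is the smallest set containing all axioms and closed under the rules (so derivations are well-founded, possibly infinitely branching trees). *)

theory Defs
  imports "HOL-Library.Multiset" "HOL-Library.Nat_Bijection"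
begin

section \<open>The calculus\<close>

datatype fm =
    Var nat
  | Zero
  | One
  | Imp fm fm  (infixr \<open>\<multimap>\<close> 65)
  | Prod fm fm  (infixl \<open>\<cdot>\<close> 70)
  | Disj fm fm
  | Conj fm fm
  | Star fm

text \<open>
  A sequent with antecedent \<open>\<Gamma>\<close> and succedent \<open>C\<close> is the pair \<open>(\<Gamma>, C)\<close>; exchange is implicit
  because antecedents are multisets.
\<close>

type_synonym sequent = "fm multiset \<times> fm"

inductive derivable :: "fm multiset \<Rightarrow> fm \<Rightarrow> bool"  (infix \<open>\<turnstile>\<close> 50) where
  Ax: "{#A#} \<turnstile> A"
| ZeroL: "\<Gamma> + {#Zero#} \<turnstile> C"
| OneR: "{#} \<turnstile> One"
| OneL: "\<Gamma> \<turnstile> C \<Longrightarrow> \<Gamma> + {#One#} \<turnstile> C"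
| ImpL: "\<Pi> \<turnstile> A \<Longrightarrow> \<Gamma> + {#B#} \<turnstile> C \<Longrightarrow> \<Gamma> + \<Pi> + {#A \<multimap> B#} \<turnstile> C"
| ImpR: "{#A#} + \<Pi> \<turnstile> B \<Longrightarrow> \<Pi> \<turnstile> A \<multimap> B"
| ProdL: "\<Gamma> + {#A#} + {#B#} \<turnstile> C \<Longrightarrow> \<Gamma> + {#A \<cdot> B#} \<turnstile> C"
| ProdR: "\<Pi> \<turnstile> A \<Longrightarrow> \<Delta> \<turnstile> B \<Longrightarrow> \<Pi> + \<Delta> \<turnstile> A \<cdot> B"
| DisjL: "\<Gamma> + {#A#} \<turnstile> C \<Longrightarrow> \<Gamma> + {#B#} \<turnstile> C \<Longrightarrow> \<Gamma> + {#Disj A B#} \<turnstile> C"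
| DisjR1: "\<Pi> \<turnstile> A \<Longrightarrow> \<Pi> \<turnstile> Disj A B"
| DisjR2: "\<Pi> \<turnstile> B \<Longrightarrow> \<Pi> \<turnstile> Disj A B"
| ConjL1: "\<Gamma> + {#A#} \<turnstile> C \<Longrightarrow> \<Gamma> + {#Conj A B#} \<turnstile> C"
| ConjL2: "\<Gamma> + {#B#} \<turnstile> C \<Longrightarrow> \<Gamma> + {#Conj A B#} \<turnstile> C"
| ConjR: "\<Pi> \<turnstile> A \<Longrightarrow> \<Pi> \<turnstile> B \<Longrightarrow> \<Pi> \<turnstile> Conj A B"
| StarL: "(\<And>n. \<Gamma> + replicate_mset n A \<turnstile> C) \<Longrightarrow> \<Gamma> + {#Star A#} \<turnstile> C"
| StarR: "(\<And>\<Pi>. \<Pi> \<in> set \<Pi>s \<Longrightarrow> \<Pi> \<turnstile> A) \<Longrightarrow> sum_list \<Pi>s \<turnstile> Star A"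
| Cut: "\<Pi> \<turnstile> A \<Longrightarrow> \<Gamma> + {#A#} \<turnstile> C \<Longrightarrow> \<Gamma> + \<Pi> \<turnstile> C"


section \<open>Encoding of sequents\<close>

primrec fm_code :: "fm \<Rightarrow> nat" where
  "fm_code (Var n) = prod_encode (0, n)"
| "fm_code Zero = prod_encode (1, 0)"
| "fm_code One = prod_encode (2, 0)"
| "fm_code (A \<multimap> B) = prod_encode (3, prod_encode (fm_code A, fm_code B))"
| "fm_code (A \<cdot> B) = prod_encode (4, prod_encode (fm_code A, fm_code B))"
| "fm_code (Disj A B) = prod_encode (5, prod_encode (fm_code A, fm_code B))"
| "fm_code (Conj A B) = prod_encode (6, prod_encode (fm_code A, fm_code B))"
| "fm_code (Star A) = prod_encode (7, fm_code A)"

text \<open>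
  An antecedent is coded by the increasingly sorted list of the codes of its members, so that
  each sequent has exactly one code.
\<close>

definition sequent_code :: "sequent \<Rightarrow> nat" where
  "sequent_code s = prod_encode
     (list_encode (sorted_list_of_multiset (image_mset fm_code (fst s))), fm_code (snd s))"

lemma inj_fm_code: "inj fm_code"
proof (rule injI)
  fix A B
  show "fm_code A = fm_code B \<Longrightarrow> A = B"
    by (induction A arbitrary: B; case_tac B) (auto simp: prod_encode_eq)
qed

lemma inj_sequent_code: "inj sequent_code"
proof (rule injI)
  fix s t
  assume "sequent_code s = sequent_code t"
  then have "sorted_list_of_multiset (image_mset fm_code (fst s)) =
      sorted_list_of_multiset (image_mset fm_code (fst t))" and "fm_code (snd s) = fm_code (snd t)"
    by (auto simp: sequent_code_def prod_encode_eq list_encode_eq)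
  then have "image_mset fm_code (fst s) = image_mset fm_code (fst t)" and "snd s = snd t"
    by (metis mset_sorted_list_of_multiset, metis inj_fm_code injD)
  then show "s = t"
    using injD[OF multiset.inj_map[OF inj_fm_code]] by (metis prod_eqI)
qed


section \<open>Recursive functions and the class \<open>\<Pi>\<^sup>0\<^sub>1\<close>\<close>

text \<open>
  \<open>recursive n f\<close>: the restriction of \<open>f\<close> to argument lists of length \<open>n\<close> is a (total) recursive
  \<open>n\<close>-ary function. Minimisation is applied to regular functions only; with this proviso
  the inductively generated class is that of all total computable functions. Rule \<open>cong\<close> makes the
  values on lists of other lengths irrelevant.
\<close>

inductive recursive :: "nat \<Rightarrow> (nat list \<Rightarrow> nat) \<Rightarrow> bool" where
  zero: "recursive n (\<lambda>xs. 0)"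
| succ: "recursive 1 (\<lambda>xs. Suc (xs ! 0))"
| proj: "i < n \<Longrightarrow> recursive n (\<lambda>xs. xs ! i)"
| comp: "recursive (length gs) f \<Longrightarrow> (\<And>g. g \<in> set gs \<Longrightarrow> recursive n g) \<Longrightarrow>
    recursive n (\<lambda>xs. f (map (\<lambda>g. g xs) gs))"
| prim: "recursive n f \<Longrightarrow> recursive (n + 2) g \<Longrightarrow>
    recursive (n + 1) (\<lambda>xs. rec_nat (f (tl xs)) (\<lambda>k r. g (k # r # tl xs)) (hd xs))"
| mu: "recursive (n + 1) f \<Longrightarrow> (\<And>xs. length xs = n \<Longrightarrow> \<exists>k. f (k # xs) = 0) \<Longrightarrow>
    recursive n (\<lambda>xs. LEAST k. f (k # xs) = 0)"
| cong: "recursive n f \<Longrightarrow> (\<And>xs. length xs = n \<Longrightarrow> g xs = f xs) \<Longrightarrow> recursive n g"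

definition recursive_rel2 :: "(nat \<Rightarrow> nat \<Rightarrow> bool) \<Rightarrow> bool" where
  "recursive_rel2 R \<longleftrightarrow> recursive 2 (\<lambda>xs. if R (xs ! 0) (xs ! 1) then 1 else 0)"

definition Pi01 :: "nat set set" where
  "Pi01 = {S. \<exists>R. recursive_rel2 R \<and> S = {x. \<forall>y. R x y}}"

end

theory Submission
  imports Defs "HOL-Library.Set_Algebras"
begin

text \<open>
  Read backwards, each cut-free rule replaces a formula by smaller ones, so cut-free proof search is
  well-founded for the multiset order on antecedent and succedent. Once the splittings with empty
  parts are excluded in \<open>*R\<close>, a given sequent is the conclusion of only finitely many rule instances.
  An underivable sequent has in every such instance an underivable premise; choosing one premise for
  each instance (one single \<open>n\<close> in the case of \<open>*L\<^sub>\<omega>\<close>) and iterating yields, by well-foundedness, a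
  finite set of sequents that meets the premises of each instance concluding in the set. Conversely, no
  member of such a set is derivable. Underivability is therefore witnessed by a finite object that can be
  checked recursively. Cuts are eliminated semantically: formulae are interpreted by sets of antecedents
  closed with respect to cut-free derivability, and \<open>A\<close> itself belongs to the interpretation of \<open>A\<close>,
  all of whose members derive \<open>A\<close> without cut.
\<close>

section \<open>Finite refutations of well-founded rule systems\<close>

text \<open>Generic in the rule system, because it serves twice: for the cut-free calculus and for
  the formation of formula codes. The premises form a set, so an omega-rule counts as one
  instance.\<close>

inductive deriv :: "('s \<Rightarrow> 's set \<Rightarrow> bool) \<Rightarrow> 's \<Rightarrow> bool" for R where
  step: "R s Ps \<Longrightarrow> (\<And>p. p \<in> Ps \<Longrightarrow> deriv R p) \<Longrightarrow> deriv R s"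

text \<open>An instance with \<open>Ps = {}\<close> has no premise to offer, so no axiom concludes
  in a refutation.\<close>

definition refutation :: "('s \<Rightarrow> 's set \<Rightarrow> bool) \<Rightarrow> 's set \<Rightarrow> bool" where
  "refutation R F \<longleftrightarrow> (\<forall>s\<in>F. \<forall>Ps. R s Ps \<longrightarrow> (\<exists>p\<in>Ps. p \<in> F))"

text \<open>Induction on the derivation: if its conclusion were in \<open>F\<close>, so would be a
  premise of its last instance, against the induction hypothesis.\<close>

lemma refutation_not_deriv:
  assumes "refutation R F" "deriv R s"
  shows "s \<notin> F"
  using assms(2,1) by induction (unfold refutation_def, meson)

text \<open>Refutations are closed under unions. By well-founded induction each instance concluding
  in \<open>s\<close> has a premise with a finite refutation, and the union of these with
  \<open>s\<close> added is finite, since only instances, not premises, need to be finitely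
  many.\<close>

lemma finite_refutation:
  assumes wf: "wf r" and dec: "\<And>s Ps p. R s Ps \<Longrightarrow> p \<in> Ps \<Longrightarrow> (p, s) \<in> r"
    and fin: "\<And>s. finite {Ps. R s Ps}"
    and "\<not> deriv R s"
  shows "\<exists>F. finite F \<and> s \<in> F \<and> refutation R F"
  using wf assms(4)
proof (induction s rule: wf_induct_rule)
  case (less s)
  have "\<exists>p F. p \<in> Ps \<and> finite F \<and> p \<in> F \<and> refutation R F" if "R s Ps" for Ps
    using less dec[OF that] deriv.step[of R, OF that] by meson
  then obtain p F where pF: "\<And>Ps. R s Ps \<Longrightarrow>
      p Ps \<in> Ps \<and> finite (F Ps) \<and> p Ps \<in> F Ps \<and> refutation R (F Ps)"
    by metis
  let ?F = "insert s (\<Union>Ps\<in>{Ps. R s Ps}. F Ps)"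
  have "\<exists>p\<in>Ps. p \<in> ?F" if "t \<in> ?F" "R t Ps" for t Ps
  proof (cases "t = s")
    case True
    then show ?thesis using that pF[of Ps] by blast
  next
    case False
    with that(1) obtain Qs where "R s Qs" "t \<in> F Qs" by auto
    then have "\<exists>p\<in>Ps. p \<in> F Qs" using pF[of Qs] that(2) unfolding refutation_def by blast
    then show ?thesis using \<open>R s Qs\<close> by blast
  qed
  then have "refutation R ?F" unfolding refutation_def by blast
  moreover have "finite ?F" using fin pF by blast
  ultimately show ?case by blast
qed

section \<open>Closure properties of recursive functions\<close>

text \<open>
  Arguments are passed as an environment \<open>e\<close>, so that \<open>e i\<close> is a de Bruijn variable: a binder puts its
  variable at index 0 and shifts the others.
\<close>

definition rec_fun :: "nat \<Rightarrow> ((nat \<Rightarrow> nat) \<Rightarrow> nat) \<Rightarrow> bool" where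
  "rec_fun n f \<longleftrightarrow> recursive n (\<lambda>xs. f ((!) xs))"

definition rec_pred :: "nat \<Rightarrow> ((nat \<Rightarrow> nat) \<Rightarrow> bool) \<Rightarrow> bool" where
  "rec_pred n P \<longleftrightarrow> rec_fun n (\<lambda>e. of_bool (P e))"

lemma nth_tl_fun: "length xs = Suc n \<Longrightarrow> (!) (tl xs) = (\<lambda>i. xs ! Suc i)"
  by (cases xs) auto

lemma rec_fun_var: "i < n \<Longrightarrow> rec_fun n (\<lambda>e. e i)"
  by (simp add: rec_fun_def recursive.proj)

lemma rec_fun_comp:
  assumes "rec_fun (length gs) f" "\<And>g. g \<in> set gs \<Longrightarrow> rec_fun n g"
  shows "rec_fun n (\<lambda>e. f (\<lambda>i. map (\<lambda>g. g e) gs ! i))"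
  using recursive.comp[of "map (\<lambda>g xs. g ((!) xs)) gs" "\<lambda>xs. f ((!) xs)" n] assms
  by (auto simp: rec_fun_def comp_def)

text \<open>Composition with \<open>b\<close> followed by the \<open>n\<close> projections. The
  projections reproduce the argument list only if it has length \<open>n\<close>, which is where
  \<open>recursive.cong\<close> comes in.\<close>

lemma rec_fun_let:
  assumes "rec_fun (Suc n) (\<lambda>e. f (e 0) (\<lambda>i. e (Suc i)))" "rec_fun n b"
  shows "rec_fun n (\<lambda>e. f (b e) e)"
proof -
  let ?gs = "b # map (\<lambda>i e. e i) [0..<n]"
  have gs: "rec_fun n g" if "g \<in> set ?gs" for g
    using that assms by (auto simp: rec_fun_var)
  have "recursive n (\<lambda>xs. f ((map (\<lambda>g. g ((!) xs)) ?gs) ! 0)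
      (\<lambda>i. (map (\<lambda>g. g ((!) xs)) ?gs) ! Suc i))"
    using rec_fun_comp[of ?gs "\<lambda>e. f (e 0) (\<lambda>i. e (Suc i))" n] assms gs
    by (simp add: rec_fun_def)
  then show ?thesis
    unfolding rec_fun_def
  proof (rule recursive.cong)
    fix xs :: "nat list"
    assume len: "length xs = n"
    then have *: "map ((\<lambda>g. g ((!) xs)) \<circ> (\<lambda>i e. e i)) [0..<n] = xs"
      by (auto intro: nth_equalityI)
    show "f (b ((!) xs)) ((!) xs) = f (map (\<lambda>g. g ((!) xs)) ?gs ! 0) (\<lambda>i. map (\<lambda>g. g ((!) xs)) ?gs ! Suc i)"
      using len * by simp
  qed
qed

lemma rec_fun_shift:
  assumes "rec_fun n f"
  shows "rec_fun (Suc n) (\<lambda>e. f (\<lambda>i. e (Suc i)))"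
proof -
  let ?gs = "map (\<lambda>i e. e (Suc i)) [0..<n]"
  have gs: "rec_fun (Suc n) g" if "g \<in> set ?gs" for g
    using that assms by (auto simp: rec_fun_var)
  have "recursive (Suc n) (\<lambda>xs. f ((!) (map (\<lambda>g. g ((!) xs)) ?gs)))"
    using rec_fun_comp[of ?gs f "Suc n"] assms gs
    by (simp add: rec_fun_def)
  then show ?thesis
    unfolding rec_fun_def
  proof (rule recursive.cong)
    fix xs :: "nat list"
    assume len: "length xs = Suc n"
    then have *: "map ((\<lambda>g. g ((!) xs)) \<circ> (\<lambda>i e. e (Suc i))) [0..<n] = tl xs"
      by (auto intro: nth_equalityI simp: nth_tl)
    show "f (\<lambda>i. xs ! Suc i) = f ((!) (map (\<lambda>g. g ((!) xs)) ?gs))"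
      using len * by (simp add: nth_tl_fun)
  qed
qed

lemma rec_fun_1:
  assumes "rec_fun 1 (\<lambda>e. f (e 0))" "rec_fun n g"
  shows "rec_fun n (\<lambda>e. f (g e))"
  using rec_fun_comp[of "[g]" "\<lambda>e. f (e 0)" n] assms by auto

lemma rec_fun_2:
  assumes "rec_fun 2 (\<lambda>e. f (e 0) (e 1))" "rec_fun n g" "rec_fun n h"
  shows "rec_fun n (\<lambda>e. f (g e) (h e))"
  using rec_fun_comp[of "[g, h]" "\<lambda>e. f (e 0) (e 1)" n] assms
  by (auto simp: numeral_2_eq_2)

lemma rec_fun_Suc: "rec_fun n f \<Longrightarrow> rec_fun n (\<lambda>e. Suc (f e))"
  using rec_fun_1[of Suc] recursive.succ by (auto simp: rec_fun_def)

lemma rec_fun_const: "rec_fun n (\<lambda>e. c)"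
proof (induction c)
  case 0
  then show ?case by (simp add: rec_fun_def recursive.zero)
qed (rule rec_fun_Suc)

text \<open>\<open>recursive.prim\<close> recurses on the first argument only;
  \<open>rec_fun_let\<close> then substitutes an arbitrary recursive bound \<open>b\<close> for
  it.\<close>

lemma rec_fun_rec_nat:
  assumes "rec_fun n f" "rec_fun (Suc (Suc n)) (\<lambda>e. g (e 0) (e 1) (\<lambda>i. e (Suc (Suc i))))"
    "rec_fun n b"
  shows "rec_fun n (\<lambda>e. rec_nat (f e) (\<lambda>k r. g k r e) (b e))"
proof (rule rec_fun_let[OF _ assms(3)])
  have "recursive (n + 1) (\<lambda>xs. rec_nat (f ((!) (tl xs)))
     (\<lambda>k r. g ((k # r # tl xs) ! 0) ((k # r # tl xs) ! 1) (\<lambda>i. (k # r # tl xs) ! Suc (Suc i))) (hd xs))"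
    using assms(1,2) unfolding rec_fun_def
    by (intro recursive.prim[of n "\<lambda>xs. f ((!) xs)"]) auto
  then show "rec_fun (Suc n) (\<lambda>e. rec_nat (f (\<lambda>i. e (Suc i))) (\<lambda>k r. g k r (\<lambda>i. e (Suc i))) (e 0))"
    unfolding rec_fun_def Suc_eq_plus1
    by (rule recursive.cong) (auto simp: nth_tl_fun[simplified] hd_conv_nth length_Suc_conv)
qed

text \<open>Weakening at index 1, where \<open>rec_fun_rec_nat\<close> keeps the accumulator: for
  parts of a recursion step that depend on the counter and the parameters alone.\<close>

lemma rec_fun_skip:
  assumes "rec_fun (Suc n) (\<lambda>e. f (e 0) (\<lambda>i. e (Suc i)))"
  shows "rec_fun (Suc (Suc n)) (\<lambda>e. f (e 0) (\<lambda>i. e (Suc (Suc i))))"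
proof -
  let ?gs = "(\<lambda>e. e 0) # map (\<lambda>i e. e (Suc (Suc i))) [0..<n]"
  have gs: "rec_fun (Suc (Suc n)) g" if "g \<in> set ?gs" for g
    using that by (auto simp: rec_fun_var)
  have "recursive (Suc (Suc n)) (\<lambda>xs. f ((map (\<lambda>g. g ((!) xs)) ?gs) ! 0)
      (\<lambda>i. (map (\<lambda>g. g ((!) xs)) ?gs) ! Suc i))"
    using rec_fun_comp[of ?gs "\<lambda>e. f (e 0) (\<lambda>i. e (Suc i))" "Suc (Suc n)"] assms gs
    by (simp add: rec_fun_def)
  then show ?thesis
    unfolding rec_fun_def
  proof (rule recursive.cong)
    fix xs :: "nat list"
    assume len: "length xs = Suc (Suc n)"
    then have *: "map ((\<lambda>g. g ((!) xs)) \<circ> (\<lambda>i e. e (Suc (Suc i)))) [0..<n] = tl (tl xs)"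
      by (auto intro: nth_equalityI simp: nth_tl)
    show "f (xs ! 0) (\<lambda>i. xs ! Suc (Suc i)) = f (map (\<lambda>g. g ((!) xs)) ?gs ! 0) (\<lambda>i. map (\<lambda>g. g ((!) xs)) ?gs ! Suc i)"
      using len * by (simp add: nth_tl_fun)
  qed
qed

section \<open>Arithmetic, Boolean operations, bounded quantifiers and minimisation\<close>

lemma rec_fun_plus: "rec_fun n f \<Longrightarrow> rec_fun n g \<Longrightarrow> rec_fun n (\<lambda>e. f e + g e)"
proof -
  assume *: "rec_fun n f" "rec_fun n g"
  have "a + b = rec_nat a (\<lambda>k r. Suc r) b" for a b :: nat
    by (induction b) auto
  then show ?thesis
    using * by (simp only:) (intro rec_fun_rec_nat rec_fun_Suc rec_fun_var; simp)
qed

text \<open>Truncated subtraction iterates the predecessor, and the predecessor is the recursion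
  that returns its counter.\<close>

lemma rec_fun_minus: "rec_fun n f \<Longrightarrow> rec_fun n g \<Longrightarrow> rec_fun n (\<lambda>e. f e - g e)"
proof -
  assume *: "rec_fun n f" "rec_fun n g"
  have 1: "a - 1 = rec_nat 0 (\<lambda>k r. k) a" for a :: nat
    by (cases a) auto
  have "rec_fun 1 (\<lambda>e. e 0 - 1)"
    unfolding 1 by (intro rec_fun_rec_nat rec_fun_const rec_fun_var; simp)
  then have 3: "rec_fun n f \<Longrightarrow> rec_fun n (\<lambda>e. f e - 1)" for n f
    by (rule rec_fun_1)
  have 2: "rec_nat a (\<lambda>k r. r - 1) b = a - b" for a b :: nat
    by (induction b) auto
  have "rec_fun n (\<lambda>e. rec_nat (f e) (\<lambda>k r. r - 1) (g e))"
    using * by (intro rec_fun_rec_nat 3 rec_fun_var; simp)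
  then show ?thesis
    unfolding 2 .
qed

lemma rec_fun_of_bool: "rec_pred n P \<Longrightarrow> rec_fun n (\<lambda>e. of_bool (P e))"
  by (simp only: rec_pred_def)

text \<open>Truth values are 0 and 1, so truncated subtraction from 1 decides the comparison;
  negation and conjunction are obtained in the same way.\<close>

lemma rec_pred_le: "rec_fun n f \<Longrightarrow> rec_fun n g \<Longrightarrow> rec_pred n (\<lambda>e. f e \<le> g e)"
proof -
  have "of_bool (a \<le> b) = 1 - (a - b)" for a b :: nat by simp
  then show "rec_fun n f \<Longrightarrow> rec_fun n g \<Longrightarrow> ?thesis"
    unfolding rec_pred_def by (simp only:) (intro rec_fun_minus rec_fun_const)
qed

lemma rec_pred_not: "rec_pred n P \<Longrightarrow> rec_pred n (\<lambda>e. \<not> P e)"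
proof -
  have "of_bool (\<not> P) = 1 - (of_bool P :: nat)" for P by simp
  then show "rec_pred n P \<Longrightarrow> ?thesis"
    unfolding rec_pred_def by (simp only:) (intro rec_fun_minus rec_fun_const)
qed

lemma rec_pred_conj: "rec_pred n P \<Longrightarrow> rec_pred n Q \<Longrightarrow> rec_pred n (\<lambda>e. P e \<and> Q e)"
proof -
  have "of_bool (P \<and> Q) = of_bool P + of_bool Q - (1 :: nat)" for P Q by simp
  then show "rec_pred n P \<Longrightarrow> rec_pred n Q \<Longrightarrow> ?thesis"
    unfolding rec_pred_def by (simp only:) (intro rec_fun_minus rec_fun_plus rec_fun_const)
qed

lemma rec_pred_disj: "rec_pred n P \<Longrightarrow> rec_pred n Q \<Longrightarrow> rec_pred n (\<lambda>e. P e \<or> Q e)"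
  using rec_pred_not[OF rec_pred_conj[OF rec_pred_not[of n P] rec_pred_not[of n Q]]] by simp

lemma rec_pred_imp: "rec_pred n P \<Longrightarrow> rec_pred n Q \<Longrightarrow> rec_pred n (\<lambda>e. P e \<longrightarrow> Q e)"
  unfolding imp_conv_disj by (intro rec_pred_disj rec_pred_not)

lemma rec_pred_less: "rec_fun n f \<Longrightarrow> rec_fun n g \<Longrightarrow> rec_pred n (\<lambda>e. f e < g e)"
  using rec_pred_le[OF rec_fun_Suc[of n f], of g] by (simp add: Suc_le_eq)

lemma rec_pred_eq:
  fixes f g :: "(nat \<Rightarrow> nat) \<Rightarrow> nat"
  shows "rec_fun n f \<Longrightarrow> rec_fun n g \<Longrightarrow> rec_pred n (\<lambda>e. f e = g e)"
  unfolding eq_iff by (intro rec_pred_conj rec_pred_le)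

lemma rec_pred_all:
  assumes "rec_fun n b" "rec_pred (Suc n) (\<lambda>e. P (e 0) (\<lambda>i. e (Suc i)))"
  shows "rec_pred n (\<lambda>e. \<forall>k<b e. P k e)"
proof -
  have *: "(of_bool (\<forall>k<b. Q k) :: nat) = rec_nat 1 (\<lambda>k r. r + of_bool (Q k) - 1) b" for b and Q :: "nat \<Rightarrow> bool"
  proof (induction b)
    case (Suc b)
    have "of_bool (\<forall>k<Suc b. Q k) = of_bool (\<forall>k<b. Q k) + of_bool (Q b) - (1 :: nat)"
      by (auto simp: less_Suc_eq)
    then show ?case unfolding Suc.IH by simp
  qed simp
  show ?thesis
    using assms unfolding rec_pred_def *
    by (intro rec_fun_rec_nat rec_fun_minus rec_fun_plus rec_fun_const rec_fun_var
      rec_fun_skip[where f = "\<lambda>k e. of_bool (P k e)"]; simp)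
qed

lemma rec_pred_ex:
  assumes "rec_fun n b" "rec_pred (Suc n) (\<lambda>e. P (e 0) (\<lambda>i. e (Suc i)))"
  shows "rec_pred n (\<lambda>e. \<exists>k<b e. P k e)"
  using rec_pred_not[OF rec_pred_all[OF assms(1) rec_pred_not[OF assms(2)]]] by simp

lemma rec_fun_sum:
  assumes "rec_fun n b" "rec_fun (Suc n) (\<lambda>e. f (e 0) (\<lambda>i. e (Suc i)))"
  shows "rec_fun n (\<lambda>e. \<Sum>k<b e. f k e)"
proof -
  have *: "(\<Sum>k<b. h k) = rec_nat 0 (\<lambda>k r. r + h k) b" for b :: nat and h :: "nat \<Rightarrow> nat"
    by (induction b) auto
  show ?thesis
    unfolding * using assms
    by (intro rec_fun_rec_nat rec_fun_plus rec_fun_const rec_fun_var rec_fun_skip; simp)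
qed

lemma rec_fun_Least:
  assumes "rec_pred (Suc n) (\<lambda>e. P (e 0) (\<lambda>i. e (Suc i)))" "\<And>e. \<exists>k. P k e"
  shows "rec_fun n (\<lambda>e. LEAST k. P k e)"
proof -
  \<comment> \<open>\<open>recursive.mu\<close> searches for a zero, hence the negation. Its
    regularity condition is \<open>assms(2)\<close>.\<close>
  let ?f = "\<lambda>xs. of_bool (\<not> P (xs ! 0) (\<lambda>i. xs ! Suc i)) :: nat"
  have "recursive (n + 1) ?f"
    using rec_pred_not[OF assms(1)] by (simp add: rec_fun_def rec_pred_def)
  then have "recursive n (\<lambda>xs. LEAST k. ?f (k # xs) = 0)"
    by (rule recursive.mu) (use assms(2) in simp)
  then show ?thesis
    by (simp add: rec_fun_def)
qed

lemma rec_pred_1: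
  assumes "rec_pred 1 (\<lambda>e. P (e 0))" "rec_fun n g"
  shows "rec_pred n (\<lambda>e. P (g e))"
  using assms unfolding rec_pred_def by (rule rec_fun_1)

lemmas rec_basic = rec_pred_le rec_pred_less rec_pred_eq rec_pred_not rec_pred_conj
  rec_pred_disj rec_pred_imp rec_pred_all rec_pred_ex rec_fun_plus rec_fun_minus rec_fun_Suc
  rec_fun_const

section \<open>Pairing and list coding\<close>

lemma rec_fun_triangle: "rec_fun n f \<Longrightarrow> rec_fun n (\<lambda>e. triangle (f e))"
proof (rule rec_fun_1[of triangle])
  have "triangle m = (\<Sum>k<m. Suc k)" for m
    by (induction m) auto
  then show "rec_fun 1 (\<lambda>e. triangle (e 0))"
    by (simp only:) (intro rec_fun_sum rec_basic rec_fun_var; simp)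
qed

lemma rec_fun_prod_encode:
  "rec_fun n f \<Longrightarrow> rec_fun n g \<Longrightarrow> rec_fun n (\<lambda>e. prod_encode (f e, g e))"
  by (simp add: prod_encode_def rec_fun_plus rec_fun_triangle)

text \<open>Pairing is inverted by search. A pair code dominates its components, which bounds
  \<open>b\<close>, and decoding is unique, so the least solution is the component.\<close>

lemma rec_fun_fst: "rec_fun n f \<Longrightarrow> rec_fun n (\<lambda>e. fst (prod_decode (f e)))"
proof (rule rec_fun_1[of "\<lambda>z. fst (prod_decode z)"])
  have "fst (prod_decode z) = (LEAST a. \<exists>b<Suc z. prod_encode (a, b) = z)" for z
    by (rule Least_equality[symmetric])
      (auto intro!: exI[of _ "snd (prod_decode z)"] simp: less_Suc_eq_le,
        metis le_prod_encode_2 prod.collapse prod_decode_inverse)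
  moreover have "\<exists>a. \<exists>b<Suc z. prod_encode (a, b) = z" for z
    by (metis le_imp_less_Suc le_prod_encode_2 prod.collapse prod_decode_inverse)
  ultimately show "rec_fun 1 (\<lambda>e. fst (prod_decode (e 0)))"
    by (simp only:) (intro rec_fun_Least rec_basic rec_fun_prod_encode rec_fun_var; simp)
qed

lemma rec_fun_snd: "rec_fun n f \<Longrightarrow> rec_fun n (\<lambda>e. snd (prod_decode (f e)))"
proof (rule rec_fun_1[of "\<lambda>z. snd (prod_decode z)"])
  have "snd (prod_decode z) = (LEAST b. prod_encode (fst (prod_decode z), b) = z)" for z
    by (rule Least_equality[symmetric]) (simp, metis order_refl prod_encode_inverse snd_conv)
  moreover have "\<exists>b. prod_encode (fst (prod_decode z), b) = z" for z
    by (metis prod.collapse prod_decode_inverse)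
  ultimately show "rec_fun 1 (\<lambda>e. snd (prod_decode (e 0)))"
    by (simp only:) (intro rec_fun_Least rec_basic rec_fun_prod_encode rec_fun_fst rec_fun_var; simp)
qed

lemma list_encode_eq_0: "list_encode xs = 0 \<longleftrightarrow> xs = []"
  by (cases xs) auto

lemma list_encode_tl: "list_encode (tl xs) = snd (prod_decode (list_encode xs - 1))"
proof (cases xs)
  case Nil
  \<comment> \<open>The tail of the empty list comes out right because \<open>0 - 1 = 0\<close>
    decodes to the pair of zeros and 0 is the code of \<open>[]\<close>.\<close>
  have "prod_decode 0 = (0, 0)"
    using prod_encode_inverse[of "(0, 0)"] by (simp add: prod_encode_def)
  then show ?thesis by (simp add: Nil)
qed simp

lemma list_encode_drop_hd:
  "k < length xs \<Longrightarrow> fst (prod_decode (list_encode (drop k xs) - 1)) = xs ! k"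
  by (simp add: Cons_nth_drop_Suc[symmetric])

lemma list_encode_drop_eq_0: "list_encode (drop k xs) = 0 \<longleftrightarrow> length xs \<le> k"
  using list_encode_eq_0[of "drop k xs"] by simp

text \<open>This bound and the next one allow quantifiers over positions and members of a coded list
  to be bounded by the code itself.\<close>

lemma length_le_list_encode: "length xs \<le> list_encode xs"
proof (induction xs)
  case (Cons x xs)
  then show ?case using le_prod_encode_2[of "list_encode xs" x] by simp
qed simp

lemma elem_less_list_encode: "x \<in> set xs \<Longrightarrow> x < list_encode xs"
proof (induction xs)
  case (Cons y xs)
  then show ?case
    using le_prod_encode_2[of "list_encode xs" y] le_prod_encode_1[of y "list_encode xs"] by auto
qed simp

text \<open>Iterated tails give access to the entries: the head of \<open>drop k\<close> is entry
  \<open>k\<close>, and code 0 signals that \<open>k\<close> is past the end.\<close>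

lemma rec_fun_drop:
  "rec_fun n f \<Longrightarrow> rec_fun n g \<Longrightarrow> rec_fun n (\<lambda>e. list_encode (drop (f e) (list_decode (g e))))"
proof (rule rec_fun_2[of "\<lambda>k l. list_encode (drop k (list_decode l))"])
  have "list_encode (drop k (list_decode l)) = rec_nat l (\<lambda>k r. snd (prod_decode (r - 1))) k" for k l
    by (induction k) (simp, simp only: drop_Suc tl_drop[symmetric] list_encode_tl old.nat.simps)
  then show "rec_fun 2 (\<lambda>e. list_encode (drop (e 0) (list_decode (e 1))))"
    by (simp only:) (intro rec_fun_rec_nat rec_basic rec_fun_snd rec_fun_var; simp)
qed

text \<open>The sum may run past the end of the list, so the code of the list can serve as its bound
  in place of the length.\<close>

lemma count_mset_nth:
  assumes "length xs \<le> n"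
  shows "count (mset xs) v = (\<Sum>k<n. of_bool (k < length xs \<and> xs ! k = v))"
  using assms
proof (induction xs arbitrary: n)
  case (Cons x xs)
  then obtain m where "n = Suc m" "length xs \<le> m"
    by (cases n) auto
  then show ?case
    using Cons.IH[of m] by (simp only: sum.lessThan_Suc_shift) auto
qed simp

lemma rec_fun_count:
  "rec_fun n f \<Longrightarrow> rec_fun n g \<Longrightarrow> rec_fun n (\<lambda>e. count (mset (list_decode (f e))) (g e))"
proof (rule rec_fun_2[of "\<lambda>l v. count (mset (list_decode l)) v"])
  have "count (mset (list_decode l)) v = (\<Sum>k<l. of_bool (0 < list_encode (drop k (list_decode l)) \<and>
      fst (prod_decode (list_encode (drop k (list_decode l)) - 1)) = v))" for l v
  proof -
    have "length (list_decode l) \<le> l"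
      using length_le_list_encode[of "list_decode l"] by simp
    then show ?thesis
      by (subst count_mset_nth) (auto intro!: sum.cong arg_cong[of _ _ of_bool]
        simp only: list_encode_drop_eq_0 list_encode_drop_hd neq0_conv[symmetric] not_le)
  qed
  then show "rec_fun 2 (\<lambda>e. count (mset (list_decode (e 0))) (e 1))"
    by (simp only:) (intro rec_fun_sum rec_fun_of_bool rec_basic rec_fun_fst rec_fun_drop rec_fun_var; simp)
qed


text \<open>
  A multiset-valued function is represented by its multiplicities together with a strict bound on the
  members, which turns equality of multisets into a bounded quantification.
\<close>

definition rec_mset :: "nat \<Rightarrow> ((nat \<Rightarrow> nat) \<Rightarrow> nat multiset) \<Rightarrow> bool" where
  "rec_mset n X \<longleftrightarrow> rec_fun (Suc n) (\<lambda>e. count (X (\<lambda>i. e (Suc i))) (e 0)) \<and>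
    (\<exists>b. rec_fun n b \<and> (\<forall>e. \<forall>v\<in>#X e. v < b e))"

lemma rec_mset_empty: "rec_mset n (\<lambda>e. {#})"
  by (auto simp: rec_mset_def intro: rec_fun_const)

lemma rec_mset_single:
  assumes "rec_fun n f"
  shows "rec_mset n (\<lambda>e. {#f e#})"
proof -
  have "count {#a#} v = of_bool (a = v)" for a v :: nat
    by simp
  then have "rec_fun (Suc n) (\<lambda>e. count {#f (\<lambda>i. e (Suc i))#} (e 0))"
    using assms by (simp only:) (intro rec_fun_of_bool rec_pred_eq rec_fun_shift rec_fun_var; simp)
  moreover have "\<forall>e. \<forall>v\<in>#{#f e#}. v < Suc (f e)"
    by simp
  ultimately show ?thesis
    unfolding rec_mset_def using rec_fun_Suc[OF assms] by blast
qed

lemma rec_mset_plus: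
  assumes "rec_mset n X" "rec_mset n Y"
  shows "rec_mset n (\<lambda>e. X e + Y e)"
proof -
  from assms obtain b c where bc: "rec_fun n b" "\<And>e v. v \<in># X e \<Longrightarrow> v < b e"
    "rec_fun n c" "\<And>e v. v \<in># Y e \<Longrightarrow> v < c e"
    by (auto simp: rec_mset_def)
  then have "rec_fun n (\<lambda>e. b e + c e)" "\<forall>e. \<forall>v\<in>#X e + Y e. v < b e + c e"
    by (auto intro: rec_fun_plus simp: trans_less_add1 trans_less_add2)
  moreover have "rec_fun (Suc n) (\<lambda>e. count (X (\<lambda>i. e (Suc i)) + Y (\<lambda>i. e (Suc i))) (e 0))"
    using assms unfolding rec_mset_def count_union by (intro rec_fun_plus) auto
  ultimately show ?thesis
    unfolding rec_mset_def by blast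
qed

lemma rec_mset_minus:
  assumes "rec_mset n X" "rec_mset n Y"
  shows "rec_mset n (\<lambda>e. X e - Y e)"
proof -
  have "rec_fun (Suc n) (\<lambda>e. count (X (\<lambda>i. e (Suc i)) - Y (\<lambda>i. e (Suc i))) (e 0))"
    using assms unfolding rec_mset_def count_diff by (intro rec_fun_minus) auto
  then show ?thesis
    using assms(1) unfolding rec_mset_def by (meson in_diffD)
qed

lemma rec_mset_shift:
  assumes "rec_mset n X"
  shows "rec_mset (Suc n) (\<lambda>e. X (\<lambda>i. e (Suc i)))"
proof -
  from assms obtain b where b: "rec_fun n b" "\<forall>e. \<forall>v\<in>#X e. v < b e"
    by (auto simp: rec_mset_def)
  have "rec_fun (Suc (Suc n)) (\<lambda>e. count (X (\<lambda>i. e (Suc (Suc i)))) (e 0))"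
    by (rule rec_fun_skip[where f = "\<lambda>v e. count (X e) v"]) (use assms in \<open>simp add: rec_mset_def\<close>)
  moreover have "rec_fun (Suc n) (\<lambda>e. b (\<lambda>i. e (Suc i)))"
    using b(1) by (rule rec_fun_shift)
  ultimately show ?thesis
    using b(2) unfolding rec_mset_def by blast
qed

lemma rec_mset_list_decode: "rec_fun n f \<Longrightarrow> rec_mset n (\<lambda>e. mset (list_decode (f e)))"
  unfolding rec_mset_def
  by (intro conjI exI[of _ f] rec_fun_count rec_fun_shift rec_fun_var)
    (auto dest: elem_less_list_encode)

lemma rec_mset_replicate:
  assumes "rec_fun n f" "rec_fun n g"
  shows "rec_mset n (\<lambda>e. replicate_mset (f e) (g e))"
proof -
  \<comment> \<open>The case distinction on \<open>v = a\<close> is written as a recursion on its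
    truth value: 0 gives multiplicity 0, and 1 gives \<open>k\<close>.\<close>
  have "count (replicate_mset k a) v = rec_nat 0 (\<lambda>_ _. k) (of_bool (v = a))" for k a v :: nat
    by simp
  then have "rec_fun (Suc n) (\<lambda>e. count (replicate_mset (f (\<lambda>i. e (Suc i))) (g (\<lambda>i. e (Suc i)))) (e 0))"
    using assms
    by (simp only:) (intro rec_fun_rec_nat rec_fun_const rec_fun_shift rec_fun_var
        rec_fun_of_bool rec_pred_eq; simp)
  moreover have "\<forall>e. \<forall>v\<in>#replicate_mset (f e) (g e). v < Suc (g e)"
    by (auto split: if_splits)
  ultimately show ?thesis
    unfolding rec_mset_def using rec_fun_Suc[OF assms(2)] by blast
qed

lemma rec_pred_mset_eq:
  assumes "rec_mset n X" "rec_mset n Y"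
  shows "rec_pred n (\<lambda>e. X e = Y e)"
proof -
  from assms obtain b c where bc: "rec_fun n b" "\<And>e v. v \<in># X e \<Longrightarrow> v < b e"
    "rec_fun n c" "\<And>e v. v \<in># Y e \<Longrightarrow> v < c e"
    by (auto simp: rec_mset_def)
  have "X e = Y e \<longleftrightarrow> (\<forall>v<b e + c e. count (X e) v = count (Y e) v)" for e
    using bc(2,4)[of _ e] by (auto simp: multiset_eq_iff)
      (metis not_in_iff trans_less_add1 trans_less_add2)
  then show ?thesis
    using assms bc by (simp only:) (intro rec_basic; simp add: rec_mset_def)
qed

lemma rec_pred_elem: "rec_fun n f \<Longrightarrow> rec_fun n g \<Longrightarrow> rec_pred n (\<lambda>e. f e \<in> set (list_decode (g e)))"
proof -
  have *: "v \<in> set (list_decode l) \<longleftrightarrow> 0 < count (mset (list_decode l)) v" for v l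
    by simp
  show "rec_fun n f \<Longrightarrow> rec_fun n g \<Longrightarrow> ?thesis"
    unfolding * by (intro rec_pred_less rec_fun_count rec_fun_const)
qed

text \<open>Comparing neighbours suffices; the disjunct with code 0 covers every position
  \<open>k\<close> that has no successor in the list.\<close>

lemma sorted_list_decode_iff:
  "sorted (list_decode l) \<longleftrightarrow> (\<forall>k<l. list_encode (drop (Suc k) (list_decode l)) = 0 \<or>
    fst (prod_decode (list_encode (drop k (list_decode l)) - 1)) \<le>
    fst (prod_decode (list_encode (drop (Suc k) (list_decode l)) - 1)))"
proof -
  have le: "length (list_decode l) \<le> l"
    using length_le_list_encode[of "list_decode l"] by simp
  have "sorted (list_decode l) \<longleftrightarrow>
      (\<forall>k. Suc k < length (list_decode l) \<longrightarrow> list_decode l ! k \<le> list_decode l ! Suc k)"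
    by (rule sorted_iff_nth_Suc)
  also have "\<dots> \<longleftrightarrow> (\<forall>k<l. list_encode (drop (Suc k) (list_decode l)) = 0 \<or>
      fst (prod_decode (list_encode (drop k (list_decode l)) - 1)) \<le>
      fst (prod_decode (list_encode (drop (Suc k) (list_decode l)) - 1)))"
  proof (intro iff_allI)
    fix k
    show "(Suc k < length (list_decode l) \<longrightarrow> list_decode l ! k \<le> list_decode l ! Suc k) \<longleftrightarrow>
      (k < l \<longrightarrow> list_encode (drop (Suc k) (list_decode l)) = 0 \<or>
        fst (prod_decode (list_encode (drop k (list_decode l)) - 1)) \<le>
        fst (prod_decode (list_encode (drop (Suc k) (list_decode l)) - 1)))"
    proof (cases "Suc k < length (list_decode l)")
      case True
      then show ?thesis
        using le by (simp only: list_encode_drop_hd[OF True] list_encode_drop_hd[OF Suc_lessD[OF True]]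
          list_encode_drop_eq_0) auto
    next
      case False
      then show ?thesis
        using list_encode_drop_eq_0[of "Suc k"] by simp
    qed
  qed
  finally show ?thesis .
qed

lemma rec_pred_sorted: "rec_fun n f \<Longrightarrow> rec_pred n (\<lambda>e. sorted (list_decode (f e)))"
  by (rule rec_pred_1[where P = "\<lambda>l. sorted (list_decode l)"], unfold sorted_list_decode_iff)
    (intro rec_basic rec_fun_fst rec_fun_drop rec_fun_var; simp)

lemmas rec_intros = rec_pred_mset_eq rec_basic rec_pred_elem rec_pred_sorted rec_mset_empty
  rec_mset_single rec_mset_plus rec_mset_minus rec_mset_list_decode rec_mset_replicate
  rec_fun_prod_encode rec_fun_fst rec_fun_snd rec_fun_var

section \<open>The cut-free calculus on codes\<close>

abbreviation c_bin :: "nat \<Rightarrow> nat \<Rightarrow> nat \<Rightarrow> nat" where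
  "c_bin t a b \<equiv> prod_encode (t, prod_encode (a, b))"

abbreviation c_star :: "nat \<Rightarrow> nat" where
  "c_star a \<equiv> prod_encode (7, a)"

text \<open>
  An instance consists of the conclusion and the set of premises. Rule \<open>*R\<^sub>n\<close> is split into binary steps.
  Excluding empty parts makes the sequent \<open>(P, A\<^sup>*)\<close> smaller than the conclusion \<open>(G + P, A\<^sup>*)\<close>. Arbitrary
  numbers may occur as formulae here; numbers that are no formula codes are harmless in a derivation of a
  coded sequent.
\<close>

inductive cf_rule :: "nat multiset \<times> nat \<Rightarrow> (nat multiset \<times> nat) set \<Rightarrow> bool" where
  Ax: "cf_rule ({#a#}, a) {}"
| ZeroL: "cf_rule (G + {#prod_encode (1, 0)#}, c) {}"
| OneR: "cf_rule ({#}, prod_encode (2, 0)) {}"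
| OneL: "cf_rule (G + {#prod_encode (2, 0)#}, c) {(G, c)}"
| ImpL: "cf_rule (G + P + {#c_bin 3 a b#}, c) {(P, a), (G + {#b#}, c)}"
| ImpR: "cf_rule (G, c_bin 3 a b) {(G + {#a#}, b)}"
| ProdL: "cf_rule (G + {#c_bin 4 a b#}, c) {(G + {#a#} + {#b#}, c)}"
| ProdR: "cf_rule (G + P, c_bin 4 a b) {(G, a), (P, b)}"
| DisjL: "cf_rule (G + {#c_bin 5 a b#}, c) {(G + {#a#}, c), (G + {#b#}, c)}"
| DisjR1: "cf_rule (G, c_bin 5 a b) {(G, a)}"
| DisjR2: "cf_rule (G, c_bin 5 a b) {(G, b)}"
| ConjL1: "cf_rule (G + {#c_bin 6 a b#}, c) {(G + {#a#}, c)}"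
| ConjL2: "cf_rule (G + {#c_bin 6 a b#}, c) {(G + {#b#}, c)}"
| ConjR: "cf_rule (G, c_bin 6 a b) {(G, a), (G, b)}"
| StarL: "cf_rule (G + {#c_star a#}, c) (range (\<lambda>k. (G + replicate_mset k a, c)))"
| StarR0: "cf_rule ({#}, c_star a) {}"
| StarR1: "G \<noteq> {#} \<Longrightarrow> cf_rule (G + P, c_star a) {(G, a), (P, c_star a)}"

abbreviation cf :: "nat multiset \<Rightarrow> nat \<Rightarrow> bool" where
  "cf G c \<equiv> deriv cf_rule (G, c)"

lemma cfI: "cf_rule (G, c) Ps \<Longrightarrow> (\<And>P d. (P, d) \<in> Ps \<Longrightarrow> cf P d) \<Longrightarrow> cf G c"
  by (rule deriv.step) auto

text \<open>Recovers the n-ary rule from binary steps. An empty part adds nothing to the sum, so it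
  is skipped rather than fed to \<open>StarR1\<close>.\<close>

lemma cf_StarR:
  "(\<And>G. G \<in> set Gs \<Longrightarrow> cf G a) \<Longrightarrow> cf (sum_list Gs) (c_star a)"
proof (induction Gs)
  case Nil
  then show ?case using cfI[OF cf_rule.StarR0] by simp
next
  case (Cons G Gs)
  then have "cf G a" "cf (sum_list Gs) (c_star a)" by simp_all
  then show ?case
    using cfI[OF cf_rule.StarR1[of G "sum_list Gs" a]] by (cases "G = {#}") auto
qed

section \<open>Cut elimination by phase semantics\<close>

text \<open>The intersection of all sets \<open>{G. cf (G + D) c}\<close> that include
  \<open>X\<close>: the closure operator of the phase space whose poles are the cut-free derivable
  sequents.\<close>

definition phase_cl :: "nat multiset set \<Rightarrow> nat multiset set" where
  "phase_cl X = {G. \<forall>D c. (\<forall>P\<in>X. cf (P + D) c) \<longrightarrow> cf (G + D) c}"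

abbreviation closed :: "nat multiset set \<Rightarrow> bool" where
  "closed X \<equiv> phase_cl X \<subseteq> X"

text \<open>A closure is taken only where the raw set might not be closed; implication and
  conjunction inherit closedness from their components.\<close>

primrec sem :: "fm \<Rightarrow> nat multiset set" where
  "sem (Var n) = {G. cf G (fm_code (Var n))}"
| "sem Zero = phase_cl {}"
| "sem One = phase_cl {{#}}"
| "sem (A \<multimap> B) = {G. \<forall>P\<in>sem A. G + P \<in> sem B}"
| "sem (A \<cdot> B) = phase_cl (sem A + sem B)"
| "sem (Disj A B) = phase_cl (sem A \<union> sem B)"
| "sem (Conj A B) = sem A \<inter> sem B"
| "sem (Star A) = phase_cl (sum_list ` lists (sem A))"

lemma phase_clI: "(\<And>D c. (\<And>P. P \<in> X \<Longrightarrow> cf (P + D) c) \<Longrightarrow> cf (G + D) c) \<Longrightarrow> G \<in> phase_cl X"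
  unfolding phase_cl_def by blast

lemma phase_clD: "G \<in> phase_cl X \<Longrightarrow> (\<And>P. P \<in> X \<Longrightarrow> cf (P + D) c) \<Longrightarrow> cf (G + D) c"
  unfolding phase_cl_def by blast

lemma subset_phase_cl: "X \<subseteq> phase_cl X"
  by (auto intro: phase_clI)

text \<open>The quantified context \<open>D\<close> of the closure absorbs the side context
  \<open>y\<close>. This is what makes left rules sound: in any side context a closure may be
  replaced by its generators.\<close>

lemma phase_cl_least:
  assumes "closed Z" "Y + X \<subseteq> Z"
  shows "Y + phase_cl X \<subseteq> Z"
proof
  fix H assume "H \<in> Y + phase_cl X"
  then obtain y x where H: "H = y + x" "y \<in> Y" "x \<in> phase_cl X"
    by (auto elim: set_plus_elim)
  have "H \<in> phase_cl Z"
  proof (rule phase_clI)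
    fix D c assume *: "\<And>P. P \<in> Z \<Longrightarrow> cf (P + D) c"
    have "cf (x + (y + D)) c"
    proof (rule phase_clD[OF H(3)])
      fix P assume "P \<in> X"
      then have "y + P \<in> Z" using H(2) assms(2) by blast
      then show "cf (P + (y + D)) c" using * by (metis add.assoc add.commute)
    qed
    then show "cf (H + D) c" by (simp add: H(1) ac_simps)
  qed
  then show "H \<in> Z" using assms(1) by blast
qed

lemma phase_cl_mono: "X \<subseteq> Y \<Longrightarrow> phase_cl X \<subseteq> phase_cl Y"
  unfolding phase_cl_def by blast

lemma closed_phase_cl: "closed (phase_cl X)"
  by (auto intro!: phase_clI dest: phase_clD elim: phase_clD)

lemma closed_cf: "closed {G. cf G c}"
  using phase_clD[of _ "{G. cf G c}" "{#}" c] by auto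

lemma closed_sem: "closed (sem A)"
proof (induction A)
  case (Imp A B)
  show ?case
  proof safe
    fix G assume G: "G \<in> phase_cl (sem (A \<multimap> B))"
    \<comment> \<open>Membership in an implication is one condition for each \<open>P\<close>; with
      \<open>{P}\<close> as side context each of them passes to the closure.\<close>
    have "{P} + phase_cl (sem (A \<multimap> B)) \<subseteq> sem B" if "P \<in> sem A" for P
      using that by (intro phase_cl_least Imp.IH) (auto elim!: set_plus_elim simp: add.commute)
    then show "G \<in> sem (A \<multimap> B)"
      using G by (auto simp: add.commute)
  qed
next
  case (Conj A B)
  then show ?case
    using phase_cl_mono[of "sem A \<inter> sem B" "sem A"] phase_cl_mono[of "sem A \<inter> sem B" "sem B"] by auto
qed (simp_all only: sem.simps closed_phase_cl closed_cf)

lemma mem_closedI: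
  "closed Z \<Longrightarrow> (\<And>D c. (\<And>P. P \<in> Z \<Longrightarrow> cf (P + D) c) \<Longrightarrow> cf (G + D) c) \<Longrightarrow> G \<in> Z"
  using phase_clI by blast

lemma phase_cl_cf: "G \<in> phase_cl X \<Longrightarrow> (\<And>P. P \<in> X \<Longrightarrow> cf P c) \<Longrightarrow> cf G c"
  using phase_clD[of G X "{#}" c] by simp

text \<open>The membership half rests on the left rule of the connective, the inclusion half on its
  right rule, with \<open>Ax\<close> for variables. The halves are proved together because
  implication exchanges them for its left component: \<open>ImpL\<close> needs the inclusion for
  \<open>A\<close>, and \<open>ImpR\<close> the membership.\<close>

lemma okada: "{#fm_code A#} \<in> sem A \<and> sem A \<subseteq> {G. cf G (fm_code A)}"
proof (induction A)
  case (Var n)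
  show ?case using cfI[OF cf_rule.Ax] by auto
next
  case Zero
  show ?case
    using cfI[OF cf_rule.ZeroL] by (auto intro!: phase_clI elim!: phase_cl_cf simp: add.commute)
next
  case One
  have "cf ({#fm_code One#} + D) c" if "cf D c" for D c
    using cfI[OF cf_rule.OneL, of D c] that by (simp add: add.commute)
  then show ?case
    using cfI[OF cf_rule.OneR] by (auto intro!: phase_clI elim!: phase_cl_cf)
next
  case (Imp A B)
  have "{#fm_code (A \<multimap> B)#} + P \<in> sem B" if "P \<in> sem A" for P
  proof (rule mem_closedI[OF closed_sem])
    fix D c assume "\<And>P. P \<in> sem B \<Longrightarrow> cf (P + D) c"
    then have "cf (D + {#fm_code B#}) c" using Imp.IH by (metis add.commute)
    moreover have "cf P (fm_code A)" using Imp.IH that by blast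
    ultimately show "cf ({#fm_code (A \<multimap> B)#} + P + D) c"
      using cfI[OF cf_rule.ImpL, of P "fm_code A" D "fm_code B" c] by (auto simp: ac_simps)
  qed
  moreover have "cf G (fm_code (A \<multimap> B))" if "G \<in> sem (A \<multimap> B)" for G
    using cfI[OF cf_rule.ImpR, of G "fm_code A" "fm_code B"] that Imp.IH by auto
  ultimately show ?case by auto
next
  case (Prod A B)
  have "{#fm_code (A \<cdot> B)#} \<in> sem (A \<cdot> B)" unfolding sem.simps
  proof (rule phase_clI)
    fix D c assume "\<And>P. P \<in> sem A + sem B \<Longrightarrow> cf (P + D) c"
    then have "cf (({#fm_code A#} + {#fm_code B#}) + D) c" using Prod.IH by blast
    then show "cf ({#fm_code (A \<cdot> B)#} + D) c"
      using cfI[OF cf_rule.ProdL, of D "fm_code A" "fm_code B" c] by (auto simp: ac_simps)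
  qed
  moreover have "cf G (fm_code (A \<cdot> B))" if "G \<in> sem (A \<cdot> B)" for G
    using that unfolding sem.simps
  proof (rule phase_cl_cf)
    fix P assume "P \<in> sem A + sem B"
    then show "cf P (fm_code (A \<cdot> B))"
      using Prod.IH cfI[OF cf_rule.ProdR, of _ "fm_code A" _ "fm_code B"]
      by (auto elim!: set_plus_elim)
  qed
  ultimately show ?case by auto
next
  case (Disj A B)
  have "{#fm_code (Disj A B)#} \<in> sem (Disj A B)" unfolding sem.simps
  proof (rule phase_clI)
    fix D c assume "\<And>P. P \<in> sem A \<union> sem B \<Longrightarrow> cf (P + D) c"
    then have "cf ({#fm_code A#} + D) c" "cf ({#fm_code B#} + D) c" using Disj.IH by blast+
    then show "cf ({#fm_code (Disj A B)#} + D) c"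
      using cfI[OF cf_rule.DisjL, of D "fm_code A" c "fm_code B"] by (auto simp: ac_simps)
  qed
  moreover have "cf G (fm_code (Disj A B))" if "G \<in> sem (Disj A B)" for G
    using that unfolding sem.simps
    by (rule phase_cl_cf) (use Disj.IH cfI[OF cf_rule.DisjR1] cfI[OF cf_rule.DisjR2] in auto)
  ultimately show ?case by auto
next
  case (Conj A B)
  have "{#fm_code (Conj A B)#} \<in> sem A"
  proof (rule mem_closedI[OF closed_sem])
    fix D c assume "\<And>P. P \<in> sem A \<Longrightarrow> cf (P + D) c"
    then have "cf (D + {#fm_code A#}) c" using Conj.IH by (metis add.commute)
    then show "cf ({#fm_code (Conj A B)#} + D) c"
      using cfI[OF cf_rule.ConjL1, of D "fm_code A" c "fm_code B"] by (auto simp: ac_simps)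
  qed
  moreover have "{#fm_code (Conj A B)#} \<in> sem B"
  proof (rule mem_closedI[OF closed_sem])
    fix D c assume "\<And>P. P \<in> sem B \<Longrightarrow> cf (P + D) c"
    then have "cf (D + {#fm_code B#}) c" using Conj.IH by (metis add.commute)
    then show "cf ({#fm_code (Conj A B)#} + D) c"
      using cfI[OF cf_rule.ConjL2, of D "fm_code B" c "fm_code A"] by (auto simp: ac_simps)
  qed
  moreover have "cf G (fm_code (Conj A B))" if "G \<in> sem (Conj A B)" for G
    using cfI[OF cf_rule.ConjR, of G "fm_code A" "fm_code B"] that Conj.IH by auto
  ultimately show ?case by auto
next
  case (Star A)
  have "{#fm_code (Star A)#} \<in> sem (Star A)" unfolding sem.simps
  proof (rule phase_clI)
    fix D c assume *: "\<And>P. P \<in> sum_list ` lists (sem A) \<Longrightarrow> cf (P + D) c"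
    have "cf (D + replicate_mset k (fm_code A)) c" for k
    proof -
      have "sum_list (replicate k {#fm_code A#}) = replicate_mset k (fm_code A)"
        by (induction k) auto
      moreover have "replicate k {#fm_code A#} \<in> lists (sem A)" using Star.IH by (auto simp: lists_eq_set)
      ultimately show ?thesis using *[of "replicate_mset k (fm_code A)"] by (metis add.commute image_eqI)
    qed
    then show "cf ({#fm_code (Star A)#} + D) c"
      using cfI[OF cf_rule.StarL, of D "fm_code A" c] by (auto simp: ac_simps)
  qed
  moreover have "cf G (fm_code (Star A))" if "G \<in> sem (Star A)" for G
    using that unfolding sem.simps
    by (rule phase_cl_cf) (use Star.IH cf_StarR in \<open>force simp: lists_eq_set\<close>)
  ultimately show ?case by auto
qed

abbreviation sem_mset :: "fm multiset \<Rightarrow> nat multiset set" where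
  "sem_mset \<Gamma> \<equiv> \<Sum>A\<in>#\<Gamma>. sem A"

text \<open>The induction covers the full calculus. Cut is harmless here: it only inserts one
  inclusion into another.\<close>

lemma derivable_sound: "\<Gamma> \<turnstile> C \<Longrightarrow> sem_mset \<Gamma> \<subseteq> sem C"
proof (induction rule: derivable.induct)
  case (ZeroL \<Gamma> C)
  show ?case
    using phase_cl_least[OF closed_sem, of "sem_mset \<Gamma>" "{}" C] by (simp add: add.commute set_plus_def)
next
  case OneR
  show ?case using subset_phase_cl[of "{{#}}"] by (simp add: set_zero)
next
  case (OneL \<Gamma> C)
  then show ?case
    using phase_cl_least[OF closed_sem, of "sem_mset \<Gamma>" "{{#}}" C] by (auto elim!: set_plus_elim simp: add.commute)
next
  case (ImpL \<Pi> A \<Gamma> B C)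
  show ?case
  proof
    fix H assume "H \<in> sem_mset (\<Gamma> + \<Pi> + {#A \<multimap> B#})"
    then obtain g p h where *: "H = g + p + h" "g \<in> sem_mset \<Gamma>" "p \<in> sem_mset \<Pi>" "h \<in> sem (A \<multimap> B)"
      by (auto elim!: set_plus_elim simp: ac_simps)
    then have "h + p \<in> sem B" using ImpL.IH by auto
    then have "g + (h + p) \<in> sem_mset (\<Gamma> + {#B#})" using *(2) set_plus_intro[of g "sem_mset \<Gamma>" "h + p" "sem B"] by (simp add: add.commute)
    then show "H \<in> sem C" using ImpL.IH *(1) by (auto simp: ac_simps)
  qed
next
  case (ImpR A \<Pi> B)
  then show ?case by (force intro: set_plus_intro simp: add.commute)
next
  case (ProdL \<Gamma> A B C)
  then show ?case
    using phase_cl_least[OF closed_sem, of "sem_mset \<Gamma>" "sem A + sem B" C] by (simp add: ac_simps)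
next
  case (ProdR \<Pi> A \<Delta> B)
  then have "sem_mset \<Pi> + sem_mset \<Delta> \<subseteq> sem A + sem B" by (intro set_plus_mono2)
  then show ?case using subset_phase_cl[of "sem A + sem B"] by auto
next
  case (DisjL \<Gamma> A C B)
  then have "sem_mset \<Gamma> + (sem A \<union> sem B) \<subseteq> sem C" by (auto elim!: set_plus_elim simp: add.commute)
  then show ?case
    using phase_cl_least[OF closed_sem, of "sem_mset \<Gamma>" "sem A \<union> sem B" C] by (simp add: ac_simps)
next
  case (DisjR1 \<Pi> A B)
  then show ?case using subset_phase_cl[of "sem A \<union> sem B"] by auto
next
  case (DisjR2 \<Pi> B A)
  then show ?case using subset_phase_cl[of "sem A \<union> sem B"] by auto
next
  case (ConjL1 \<Gamma> A C B)
  then show ?case by (auto elim!: set_plus_elim simp: add.commute)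
next
  case (ConjL2 \<Gamma> B C A)
  then show ?case by (auto elim!: set_plus_elim simp: add.commute)
next
  case (StarL \<Gamma> A C)
  \<comment> \<open>A list of \<open>n\<close> members of \<open>sem A\<close> is handled by the
    premise of the omega-rule with \<open>n\<close> copies of \<open>A\<close>.\<close>
  have "sum_list Ps \<in> (\<Sum>A\<in>#replicate_mset (length Ps) A. sem A)" if "set Ps \<subseteq> sem A" for Ps
    using that by (induction Ps) (auto simp: set_zero intro!: set_plus_intro)
  then have "sem_mset \<Gamma> + sum_list ` lists (sem A) \<subseteq> sem C"
    using StarL.IH by (force elim!: set_plus_elim simp: lists_eq_set)
  then show ?case
    using phase_cl_least[OF closed_sem, of "sem_mset \<Gamma>" "sum_list ` lists (sem A)" C]
    by (simp add: add.commute)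
next
  case (StarR \<Pi>s A)
  have "sem_mset (sum_list \<Pi>s) \<subseteq> sum_list ` lists (sem A)"
    using StarR.IH
  proof (induction \<Pi>s)
    case Nil
    then show ?case by (auto intro: image_eqI[of _ _ "[]"])
  next
    case (Cons \<Pi> \<Pi>s)
    show ?case
    proof
      fix H assume "H \<in> sem_mset (sum_list (\<Pi> # \<Pi>s))"
      then obtain p q where "H = p + q" "p \<in> sem_mset \<Pi>" "q \<in> sem_mset (sum_list \<Pi>s)"
        by (auto elim!: set_plus_elim)
      moreover from this obtain Ps where "q = sum_list Ps" "Ps \<in> lists (sem A)"
        using Cons by fastforce
      moreover have "p \<in> sem A" using Cons.prems[of \<Pi>] \<open>p \<in> sem_mset \<Pi>\<close> by auto
      ultimately have "H = sum_list (p # Ps)" "p # Ps \<in> lists (sem A)" by auto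
      then show "H \<in> sum_list ` lists (sem A)" by blast
    qed
  qed
  then show ?case using subset_phase_cl[of "sum_list ` lists (sem A)"] by auto
next
  case (Cut \<Pi> A \<Gamma> C)
  then show ?case
    by (auto elim!: set_plus_elim) (metis add.commute set_plus_intro subsetD)
qed auto

text \<open>Cut elimination: by \<open>okada\<close> the antecedent belongs to its own
  interpretation, soundness carries it into \<open>sem C\<close>, and \<open>okada\<close> turns
  this into a cut-free derivation.\<close>

lemma derivable_imp_cf:
  assumes "\<Gamma> \<turnstile> C"
  shows "cf (image_mset fm_code \<Gamma>) (fm_code C)"
proof -
  have "image_mset fm_code \<Gamma> \<in> sem_mset \<Gamma>"
    using okada by (induction \<Gamma>) (auto simp: set_zero intro: set_plus_intro[of "{#_#}", simplified])
  then show ?thesis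
    using derivable_sound[OF assms] okada[of C] by blast
qed

section \<open>From coded cut-free derivations to derivations\<close>

lemma image_mset_eq_plus_singleD:
  assumes "image_mset f \<Gamma> = G + {#d#}"
  obtains \<Delta> D where "\<Gamma> = \<Delta> + {#D#}" "G = image_mset f \<Delta>" "d = f D"
  using assms msed_map_invR[of f \<Gamma> d G] by auto

lemma fm_code_inv:
  "fm_code C = prod_encode (2, 0) \<Longrightarrow> C = One"
  "fm_code C = prod_encode (1, 0) \<Longrightarrow> C = Zero"
  "fm_code C = c_bin 3 a b \<Longrightarrow> \<exists>A B. C = A \<multimap> B \<and> a = fm_code A \<and> b = fm_code B"
  "fm_code C = c_bin 4 a b \<Longrightarrow> \<exists>A B. C = A \<cdot> B \<and> a = fm_code A \<and> b = fm_code B"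
  "fm_code C = c_bin 5 a b \<Longrightarrow> \<exists>A B. C = Disj A B \<and> a = fm_code A \<and> b = fm_code B"
  "fm_code C = c_bin 6 a b \<Longrightarrow> \<exists>A B. C = Conj A B \<and> a = fm_code A \<and> b = fm_code B"
  "fm_code C = c_star a \<Longrightarrow> \<exists>A. C = Star A \<and> a = fm_code A"
  by (cases C; simp)+

text \<open>The binary step costs two cuts against \<open>A, Star A\<close> deriving
  \<open>Star A\<close>. That sequent follows by the omega-rule, as \<open>n + 1\<close> copies of
  \<open>A\<close> derive \<open>Star A\<close>.\<close>

lemma derivable_StarR_cons:
  assumes "\<Pi> \<turnstile> A" "\<Delta> \<turnstile> Star A"
  shows "\<Pi> + \<Delta> \<turnstile> Star A"
proof -
  have "{#A#} + replicate_mset n A \<turnstile> Star A" for n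
  proof -
    have "sum_list (replicate (Suc n) {#A#}) \<turnstile> Star A"
      by (rule derivable.StarR) (auto intro: derivable.Ax split: if_splits)
    moreover have "sum_list (replicate m {#A#}) = replicate_mset m A" for m
      by (induction m) auto
    ultimately show ?thesis by simp
  qed
  then have "{#A#} + {#Star A#} \<turnstile> Star A"
    by (rule derivable.StarL)
  from derivable.Cut[OF assms(2) this] have "\<Delta> + {#A#} \<turnstile> Star A"
    by (simp add: add.commute)
  from derivable.Cut[OF assms(1) this] show ?thesis
    by (simp add: add.commute)
qed

text \<open>Cut-free premises consist of formulae of the conclusion and their immediate components,
  so in a derivation of a coded sequent every sequent can be decoded.\<close>

lemma cf_imp_derivable:
  "deriv cf_rule s \<Longrightarrow> s = (image_mset fm_code \<Gamma>, fm_code C) \<Longrightarrow> \<Gamma> \<turnstile> C"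
proof (induction arbitrary: \<Gamma> C rule: deriv.induct)
  case (step s Ps)
  have IH: "(image_mset fm_code \<Delta>, fm_code D) \<in> Ps \<Longrightarrow> \<Delta> \<turnstile> D" for \<Delta> D
    using step.IH by blast
  from step.hyps(1)[unfolded step.prems] show ?case
  proof cases
    case Ax
    then have "image_mset fm_code \<Gamma> = {#} + {#fm_code C#}" by simp
    then obtain \<Delta> D where "\<Gamma> = \<Delta> + {#D#}" "{#} = image_mset fm_code \<Delta>" "fm_code C = fm_code D"
      by (rule image_mset_eq_plus_singleD)
    then have "\<Gamma> = {#C#}" using injD[OF inj_fm_code] by auto
    then show ?thesis by (simp add: derivable.Ax)
  next
    case (ZeroL G)
    from ZeroL(1) obtain \<Delta> D where "\<Gamma> = \<Delta> + {#D#}" "G = image_mset fm_code \<Delta>"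
      "prod_encode (1, 0) = fm_code D" by (rule image_mset_eq_plus_singleD)
    then show ?thesis
      using fm_code_inv(2)[of D] derivable.ZeroL by auto
  next
    case OneR
    then show ?thesis using fm_code_inv(1)[of C] derivable.OneR by auto
  next
    case (OneL G)
    from OneL(1) obtain \<Delta> D where "\<Gamma> = \<Delta> + {#D#}" "G = image_mset fm_code \<Delta>"
      "prod_encode (2, 0) = fm_code D" by (rule image_mset_eq_plus_singleD)
    then show ?thesis
      using IH[of \<Delta> C] OneL fm_code_inv(1)[of D] derivable.OneL by auto
  next
    case (ImpL G P a b)
    from ImpL(1) obtain \<Delta> D where *: "\<Gamma> = \<Delta> + {#D#}" "G + P = image_mset fm_code \<Delta>"
      "c_bin 3 a b = fm_code D" by (rule image_mset_eq_plus_singleD)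
    obtain \<Delta>1 \<Delta>2 where "\<Delta> = \<Delta>1 + \<Delta>2" "G = image_mset fm_code \<Delta>1" "P = image_mset fm_code \<Delta>2"
      using image_mset_eq_plusD[OF *(2)[symmetric]] by blast
    moreover obtain A B where "D = A \<multimap> B" "a = fm_code A" "b = fm_code B"
      using fm_code_inv(3)[OF *(3)[symmetric]] by blast
    ultimately show ?thesis
      using IH[of \<Delta>2 A] IH[of "\<Delta>1 + {#B#}" C] ImpL derivable.ImpL *(1) by auto
  next
    case (ImpR a b)
    then obtain A B where "C = A \<multimap> B" "a = fm_code A" "b = fm_code B"
      using fm_code_inv(3) by blast
    then show ?thesis
      using IH[of "{#A#} + \<Gamma>" B] ImpR derivable.ImpR by auto
  next
    case (ProdL G a b)
    from ProdL(1) obtain \<Delta> D where *: "\<Gamma> = \<Delta> + {#D#}" "G = image_mset fm_code \<Delta>"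
      "c_bin 4 a b = fm_code D" by (rule image_mset_eq_plus_singleD)
    moreover obtain A B where "D = A \<cdot> B" "a = fm_code A" "b = fm_code B"
      using fm_code_inv(4)[OF *(3)[symmetric]] by blast
    ultimately show ?thesis
      using IH[of "\<Delta> + {#A#} + {#B#}" C] ProdL derivable.ProdL by auto
  next
    case (ProdR G P a b)
    obtain \<Delta>1 \<Delta>2 where "\<Gamma> = \<Delta>1 + \<Delta>2" "G = image_mset fm_code \<Delta>1" "P = image_mset fm_code \<Delta>2"
      using image_mset_eq_plusD[OF ProdR(1)] by blast
    moreover obtain A B where "C = A \<cdot> B" "a = fm_code A" "b = fm_code B"
      using fm_code_inv(4)[OF ProdR(2)] by blast
    ultimately show ?thesis
      using IH[of \<Delta>1 A] IH[of \<Delta>2 B] ProdR derivable.ProdR by auto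
  next
    case (DisjL G a b)
    from DisjL(1) obtain \<Delta> D where *: "\<Gamma> = \<Delta> + {#D#}" "G = image_mset fm_code \<Delta>"
      "c_bin 5 a b = fm_code D" by (rule image_mset_eq_plus_singleD)
    moreover obtain A B where "D = Disj A B" "a = fm_code A" "b = fm_code B"
      using fm_code_inv(5)[OF *(3)[symmetric]] by blast
    ultimately show ?thesis
      using IH[of "\<Delta> + {#A#}" C] IH[of "\<Delta> + {#B#}" C] DisjL derivable.DisjL by auto
  next
    case (DisjR1 a b)
    then show ?thesis
      using fm_code_inv(5)[OF DisjR1(1)] IH derivable.DisjR1 by auto
  next
    case (DisjR2 b a)
    then show ?thesis
      using fm_code_inv(5)[OF DisjR2(1)] IH derivable.DisjR2 by auto
  next
    case (ConjL1 G a b)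
    from ConjL1(1) obtain \<Delta> D where *: "\<Gamma> = \<Delta> + {#D#}" "G = image_mset fm_code \<Delta>"
      "c_bin 6 a b = fm_code D" by (rule image_mset_eq_plus_singleD)
    moreover obtain A B where "D = Conj A B" "a = fm_code A" "b = fm_code B"
      using fm_code_inv(6)[OF *(3)[symmetric]] by blast
    ultimately show ?thesis
      using IH[of "\<Delta> + {#A#}" C] ConjL1 derivable.ConjL1 by auto
  next
    case (ConjL2 G a b)
    from ConjL2(1) obtain \<Delta> D where *: "\<Gamma> = \<Delta> + {#D#}" "G = image_mset fm_code \<Delta>"
      "c_bin 6 a b = fm_code D" by (rule image_mset_eq_plus_singleD)
    moreover obtain A B where "D = Conj A B" "a = fm_code A" "b = fm_code B"
      using fm_code_inv(6)[OF *(3)[symmetric]] by blast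
    ultimately show ?thesis
      using IH[of "\<Delta> + {#B#}" C] ConjL2 derivable.ConjL2 by auto
  next
    case (ConjR a b)
    then obtain A B where "C = Conj A B" "a = fm_code A" "b = fm_code B"
      using fm_code_inv(6) by blast
    then show ?thesis
      using IH[of \<Gamma> A] IH[of \<Gamma> B] ConjR derivable.ConjR by auto
  next
    case (StarL G a)
    from StarL(1) obtain \<Delta> D where *: "\<Gamma> = \<Delta> + {#D#}" "G = image_mset fm_code \<Delta>"
      "c_star a = fm_code D" by (rule image_mset_eq_plus_singleD)
    moreover obtain A where "D = Star A" "a = fm_code A"
      using fm_code_inv(7)[OF *(3)[symmetric]] by blast
    moreover have "\<Delta> + replicate_mset k A \<turnstile> C" for k
      using IH[of "\<Delta> + replicate_mset k A" C] StarL calculation by auto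
    ultimately show ?thesis
      using derivable.StarL by auto
  next
    case (StarR0 a)
    then show ?thesis
      using fm_code_inv(7)[of C a] derivable.StarR[of "[]"] by auto
  next
    case (StarR1 G P a)
    obtain \<Delta>1 \<Delta>2 where "\<Gamma> = \<Delta>1 + \<Delta>2" "G = image_mset fm_code \<Delta>1" "P = image_mset fm_code \<Delta>2"
      using image_mset_eq_plusD[OF StarR1(1)] by blast
    moreover obtain A where "C = Star A" "a = fm_code A"
      using fm_code_inv(7)[OF StarR1(2)] by blast
    ultimately show ?thesis
      using IH[of \<Delta>1 A] IH[of \<Delta>2 C] StarR1 derivable_StarR_cons by auto
  qed
qed

section \<open>Finite refutations of underivable sequents\<close>

lemma prod_encode_mono2: "b \<le> b' \<Longrightarrow> prod_encode (a, b) \<le> prod_encode (a, b')"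
proof -
  have "triangle m \<le> triangle (m + k)" for m k
    by (induction k) auto
  then show "b \<le> b' \<Longrightarrow> ?thesis"
    unfolding prod_encode_def by (auto simp: le_iff_add add.assoc[symmetric])
qed

text \<open>Deleting entries from a list does not increase its code. Splittings of an antecedent can
  therefore be searched below its code.\<close>

lemma submset_code:
  assumes "X \<subseteq># mset (list_decode l)"
  obtains k where "k \<le> l" "mset (list_decode k) = X"
proof -
  have "\<exists>ys. mset ys = X \<and> list_encode ys \<le> list_encode xs" if "X \<subseteq># mset xs" for xs X
    using that
  proof (induction xs arbitrary: X)
    case (Cons x xs)
    show ?case
    proof (cases "x \<in># X")
      case True
      then have "X - {#x#} \<subseteq># mset xs"
        using Cons.prems by (simp add: subset_eq_diff_conv)
      then obtain ys where "mset ys = X - {#x#}" "list_encode ys \<le> list_encode xs"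
        using Cons.IH by blast
      then show ?thesis
        using True prod_encode_mono2 by (intro exI[of _ "x # ys"]) auto
    next
      case False
      then have "X \<subseteq># mset xs"
        using Cons.prems by (metis diff_single_trivial mset.simps(2) subset_eq_diff_conv add_mset_add_single)
      then obtain ys where "mset ys = X" "list_encode ys \<le> list_encode xs"
        using Cons.IH by blast
      then show ?thesis
        using le_prod_encode_2[of "list_encode xs" x] by (intro exI[of _ ys]) auto
    qed
  qed simp
  from this[OF assms] obtain ys where "mset ys = X" "list_encode ys \<le> l"
    by auto
  then show ?thesis
    using that[of "list_encode ys"] by simp
qed

lemma mset_code: obtains l where "mset (list_decode l) = X"
  using ex_mset[of X] by (metis list_encode_inverse)

lemma finite_submsets: "finite {X. X \<subseteq># (G :: nat multiset)}"
proof -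
  obtain l where l: "mset (list_decode l) = G"
    by (rule mset_code)
  have "{X. X \<subseteq># G} \<subseteq> (\<lambda>k. mset (list_decode k)) ` {..l}"
    using submset_code[of _ l] by (force simp: l)
  then show ?thesis
    by (rule finite_subset) simp
qed

text \<open>Compound formulae carry positive tags, so their components have strictly smaller codes.
  With tag 0 the claim fails for \<open>b = 0\<close>.\<close>

lemma prod_encode_less: "0 < t \<Longrightarrow> b < prod_encode (t, b)"
proof -
  have "k \<le> triangle k" for k
    by (induction k) auto
  from this[of "t + b"] show "0 < t \<Longrightarrow> ?thesis"
    by (simp add: prod_encode_def)
qed

lemma c_bin_less: "0 < t \<Longrightarrow> a < c_bin t a b \<and> b < c_bin t a b"
  using prod_encode_less[of t "prod_encode (a, b)"] le_prod_encode_1[of a b] le_prod_encode_2[of b a]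
  by auto

text \<open>A premise has a submultiset of \<open>H\<close> with at most two added formulae as
  antecedent, and all added formulae and succedents lie in \<open>N\<close>, the codes up to those
  in \<open>s\<close>. This leaves finitely many sequents \<open>U\<close> and hence finitely many
  sets of them.\<close>

lemma finite_cf_rule: "finite {Ps. cf_rule s Ps}"
proof -
  obtain H c where s: "s = (H, c)" by fastforce
  define N where "N = (\<Union>d\<in>insert c (set_mset H). {..d})"
  define S where "S = {X. X \<subseteq># H}"
  define T where "T = insert {#} ((\<lambda>a. {#a#}) ` N) \<union> (\<lambda>(a, b). {#a#} + {#b#}) ` (N \<times> N)"
  define U where "U = (\<lambda>(X, Y). X + Y) ` (S \<times> T) \<times> N"
  \<comment> \<open>The premise sets of \<open>StarL\<close> are infinite and escape
    \<open>Pow U\<close>, but each is determined by the side context and \<open>a\<close>.\<close>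
  define V where "V = (\<lambda>(X, a). range (\<lambda>k. (X + replicate_mset k a, c))) ` (S \<times> N)"
  have fin: "finite (Pow U \<union> V)"
    unfolding N_def S_def T_def U_def V_def by (simp add: finite_submsets)
  have U: "(X + Y, d) \<in> U" if "X \<subseteq># H" "Y \<in> T" "d \<in> N" for X Y d
    using that imageI[of "(X, Y)" "S \<times> T" "\<lambda>(X, Y). X + Y"] by (simp add: U_def S_def)
  have U0: "(X, d) \<in> U" if "X \<subseteq># H" "d \<in> N" for X d
    using U[OF that(1) _ that(2), of "{#}"] by (simp add: T_def)
  have U1: "(X + {#a#}, d) \<in> U" if "X \<subseteq># H" "a \<in> N" "d \<in> N" for X a d
    using that by (intro U) (simp_all add: T_def)
  have U2: "(X + {#a#} + {#b#}, d) \<in> U" if "X \<subseteq># H" "a \<in> N" "b \<in> N" "d \<in> N" for X a b d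
  proof -
    have "{#a#} + {#b#} \<in> T"
      using that imageI[of "(a, b)" "N \<times> N" "\<lambda>(a, b). {#a#} + {#b#}"] by (simp add: T_def)
    then show ?thesis
      using U[OF that(1) _ that(4)] by (simp only: add.assoc)
  qed
  have V: "range (\<lambda>k. (X + replicate_mset k a, c)) \<in> V" if "X \<subseteq># H" "a \<in> N" for X a
    using that imageI[of "(X, a)" "S \<times> N" "\<lambda>(X, a). range (\<lambda>k. (X + replicate_mset k a, c))"]
    by (simp add: V_def S_def)
  have c: "c \<in> N"
    by (simp add: N_def)
  have H: "set_mset H \<subseteq> N"
    by (auto simp: N_def)
  have down: "a \<in> N" if "d \<in> N" "a < d" for a d
  proof -
    obtain e where "e \<in> insert c (set_mset H)" "d \<le> e"
      using \<open>d \<in> N\<close> unfolding N_def by blast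
    then have "e \<in> insert c (set_mset H)" "a \<in> {..e}"
      using \<open>a < d\<close> by simp_all
    then show ?thesis
      unfolding N_def by (rule UN_I)
  qed
  have bin: "a \<in> N \<and> b \<in> N" if "c_bin t a b \<in> N" "0 < t" for t a b
    using down[OF that(1), of a] down[OF that(1), of b] c_bin_less[OF that(2), of a b] by simp
  have "Ps \<in> Pow U \<union> V" if "cf_rule (H, c) Ps" for Ps
    using that
  proof cases
    case (OneL G)
    then show ?thesis using U0[of G c] c by simp
  next
    case (ImpL G P a b)
    then have "c_bin 3 a b \<in> N" using H by auto
    then show ?thesis using ImpL bin[of 3 a b] c U0[of P a] U1[of G b c] by simp
  next
    case (ImpR a b)
    then show ?thesis using bin[of 3 a b] c U1[of H a b] by simp
  next
    case (ProdL G a b)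
    then have "c_bin 4 a b \<in> N" using H by auto
    then show ?thesis using ProdL bin[of 4 a b] c U2[of G a b c] by simp
  next
    case (ProdR G P a b)
    then show ?thesis using bin[of 4 a b] c U0[of G a] U0[of P b] by simp
  next
    case (DisjL G a b)
    then have "c_bin 5 a b \<in> N" using H by auto
    then show ?thesis using DisjL bin[of 5 a b] c U1[of G a c] U1[of G b c] by simp
  next
    case (DisjR1 a b)
    then show ?thesis using bin[of 5 a b] c U0[of H a] by simp
  next
    case (DisjR2 a b)
    then show ?thesis using bin[of 5 a b] c U0[of H b] by simp
  next
    case (ConjL1 G a b)
    then have "c_bin 6 a b \<in> N" using H by auto
    then show ?thesis using ConjL1 bin[of 6 a b] c U1[of G a c] by simp
  next
    case (ConjL2 G a b)
    then have "c_bin 6 a b \<in> N" using H by auto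
    then show ?thesis using ConjL2 bin[of 6 a b] c U1[of G b c] by simp
  next
    case (ConjR a b)
    then show ?thesis using bin[of 6 a b] c U0[of H a] U0[of H b] by simp
  next
    case (StarL G a)
    then show ?thesis
      using V[of G a] down[of "c_star a" a] H by (simp add: prod_encode_less)
  next
    case (StarR1 G P a)
    then show ?thesis
      using down[of "c_star a" a] c by (simp add: prod_encode_less U0)
  qed simp_all
  then have "{Ps. cf_rule s Ps} \<subseteq> Pow U \<union> V"
    by (auto simp: s)
  then show ?thesis
    using fin finite_subset by blast
qed

lemma less_mset_extend:
  fixes I J K :: "nat multiset"
  shows "J \<noteq> {#} \<Longrightarrow> (\<And>k. k \<in># K \<Longrightarrow> \<exists>j\<in>#J. k < j) \<Longrightarrow> I + K < I + J"
  unfolding less_multiset_def by (rule one_step_implies_multp) auto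

text \<open>Antecedent and succedent are joined into one multiset. Any number of smaller codes lies
  below the single principal one, which is why even \<open>k\<close> copies of \<open>a\<close> lie
  below \<open>c_star a\<close>.\<close>

lemma cf_rule_decreasing:
  assumes "cf_rule s Ps" "p \<in> Ps"
  shows "fst p + {#snd p#} < fst s + {#snd s#}"
  using assms
proof cases
  case (OneL G c)
  then show ?thesis
    using assms(2) less_mset_extend[of "{#prod_encode (2, 0)#}" "{#}" "G + {#c#}"] by (auto simp: ac_simps)
next
  case (ImpL G P a b c)
  consider "p = (P, a)" | "p = (G + {#b#}, c)" using ImpL assms(2) by auto
  then show ?thesis
  proof cases
    case 1
    then show ?thesis
      using less_mset_extend[of "G + {#c_bin 3 a b#} + {#c#}" "{#a#}" P] c_bin_less[of 3 a b] ImpL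
      by (auto simp: ac_simps)
  next
    case 2
    then show ?thesis
      using less_mset_extend[of "P + {#c_bin 3 a b#}" "{#b#}" "G + {#c#}"] c_bin_less[of 3 a b] ImpL
      by (auto simp: ac_simps)
  qed
next
  case (ImpR G a b)
  then show ?thesis
    using assms(2) less_mset_extend[of "{#c_bin 3 a b#}" "{#a#} + {#b#}" G] c_bin_less[of 3 a b]
    by (auto simp: ac_simps)
next
  case (ProdL G a b c)
  then show ?thesis
    using assms(2) less_mset_extend[of "{#c_bin 4 a b#}" "{#a#} + {#b#}" "G + {#c#}"] c_bin_less[of 4 a b]
    by (auto simp: ac_simps)
next
  case (ProdR G P a b)
  then show ?thesis
    using assms(2) less_mset_extend[of "P + {#c_bin 4 a b#}" "{#a#}" G]
      less_mset_extend[of "G + {#c_bin 4 a b#}" "{#b#}" P] c_bin_less[of 4 a b]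
    by (auto simp: ac_simps)
next
  case (DisjL G a b c)
  then show ?thesis
    using assms(2) less_mset_extend[of "{#c_bin 5 a b#}" "{#a#}" "G + {#c#}"]
      less_mset_extend[of "{#c_bin 5 a b#}" "{#b#}" "G + {#c#}"] c_bin_less[of 5 a b]
    by (auto simp: ac_simps)
next
  case (DisjR1 G a b)
  then show ?thesis
    using assms(2) less_mset_extend[of "{#c_bin 5 a b#}" "{#a#}" G] c_bin_less[of 5 a b]
    by (auto simp: ac_simps)
next
  case (DisjR2 G a b)
  then show ?thesis
    using assms(2) less_mset_extend[of "{#c_bin 5 a b#}" "{#b#}" G] c_bin_less[of 5 a b]
    by (auto simp: ac_simps)
next
  case (ConjL1 G a b c)
  then show ?thesis
    using assms(2) less_mset_extend[of "{#c_bin 6 a b#}" "{#a#}" "G + {#c#}"] c_bin_less[of 6 a b]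
    by (auto simp: ac_simps)
next
  case (ConjL2 G a b c)
  then show ?thesis
    using assms(2) less_mset_extend[of "{#c_bin 6 a b#}" "{#b#}" "G + {#c#}"] c_bin_less[of 6 a b]
    by (auto simp: ac_simps)
next
  case (ConjR G a b)
  then show ?thesis
    using assms(2) less_mset_extend[of "{#c_bin 6 a b#}" "{#a#}" G]
      less_mset_extend[of "{#c_bin 6 a b#}" "{#b#}" G] c_bin_less[of 6 a b]
    by (auto simp: ac_simps)
next
  case (StarL G a c)
  have "G + {#c#} + replicate_mset k a < G + {#c#} + {#c_star a#}" for k
    using prod_encode_less[of 7 a] by (intro less_mset_extend) (auto split: if_splits)
  then show ?thesis
    using assms(2) StarL by (auto simp: ac_simps)
next
  case (StarR1 G P a)
  then show ?thesis
    using assms(2) less_mset_extend[of "P + {#c_star a#}" "{#a#}" G]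
      less_mset_extend[of G "{#}" "P + {#c_star a#}"] prod_encode_less[of 7 a]
    by (auto simp: ac_simps)
qed auto

lemma cf_refutation:
  assumes "\<not> cf X c"
  shows "\<exists>F. finite F \<and> (X, c) \<in> F \<and> refutation cf_rule F"
proof (rule finite_refutation)
  show "wf (inv_image {(M, N :: nat multiset). M < N} (\<lambda>s. fst s + {#snd s#}))"
    using wfp_less_multiset[where 'a = nat] by (intro wf_inv_image) (simp add: wfp_def)
qed (use assms finite_cf_rule cf_rule_decreasing in auto)

text \<open>
  A number that does not code a formula is certified by a finite refutation in a second rule system, so
  that the set of formula codes itself need not be shown recursive.
\<close>

inductive fm_rule :: "nat \<Rightarrow> nat set \<Rightarrow> bool" where
  "fm_rule (prod_encode (0, n)) {}"
| "fm_rule (prod_encode (1, 0)) {}"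
| "fm_rule (prod_encode (2, 0)) {}"
| "t \<in> {3, 4, 5, 6} \<Longrightarrow> fm_rule (c_bin t a b) {a, b}"
| "fm_rule (c_star a) {a}"

lemma deriv_fm_rule_iff: "deriv fm_rule d \<longleftrightarrow> d \<in> range fm_code"
proof
  show "deriv fm_rule d \<Longrightarrow> d \<in> range fm_code"
  proof (induction rule: deriv.induct)
    case (step d Ps)
    from step.hyps(1) show ?case
    proof cases
      case (4 t a b)
      then have "a \<in> range fm_code" "b \<in> range fm_code" using step.IH by auto
      then obtain A B where "a = fm_code A" "b = fm_code B" by blast
      then have "d \<in> {fm_code (A \<multimap> B), fm_code (A \<cdot> B), fm_code (Disj A B), fm_code (Conj A B)}"
        using 4 by auto
      then show ?thesis by blast
    qed (use step.IH in \<open>auto intro: range_eqI[of _ _ Zero] range_eqI[of _ _ One] range_eqI[of _ _ "Var _"] range_eqI[of _ _ "Star _"]\<close>)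
  qed
  have "deriv fm_rule (fm_code A)" for A
    by (induction A) (auto intro: deriv.step fm_rule.intros fm_rule.intros(2)[simplified])
  then show "d \<in> range fm_code \<Longrightarrow> deriv fm_rule d" by auto
qed

lemma fm_rule_decreasing: "fm_rule d Ps \<Longrightarrow> a \<in> Ps \<Longrightarrow> a < d"
  by (induction rule: fm_rule.induct) (auto intro: c_bin_less[THEN conjunct1] c_bin_less[THEN conjunct2] prod_encode_less)

lemma finite_fm_rule: "finite {Ps. fm_rule d Ps}"
proof -
  have "{Ps. fm_rule d Ps} \<subseteq> Pow {..<d}"
    using fm_rule_decreasing by blast
  then show ?thesis
    by (rule finite_subset) simp
qed

lemma fm_refutation:
  assumes "d \<notin> range fm_code"
  shows "\<exists>F. finite F \<and> d \<in> F \<and> refutation fm_rule F"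
  by (rule finite_refutation[where r = less_than])
    (use assms finite_fm_rule fm_rule_decreasing deriv_fm_rule_iff in auto)

section \<open>Recursiveness of refutations\<close>

abbreviation mset_of :: "nat \<Rightarrow> nat multiset" where
  "mset_of l \<equiv> mset (list_decode l)"

text \<open>Antecedents are compared as multisets, so the lists coded in \<open>y\<close> may be in
  any order. The bound \<open>e < y\<close> makes the quantifier recursive and loses nothing, as
  members of a list lie below its code.\<close>

definition in_seqs :: "nat \<Rightarrow> nat multiset \<Rightarrow> nat \<Rightarrow> bool" where
  "in_seqs y X c \<longleftrightarrow> (\<exists>e<y. e \<in> set (list_decode y) \<and> mset_of (fst (prod_decode e)) = X \<and> snd (prod_decode e) = c)"

lemma rec_pred_in_seqs:
  assumes "rec_fun n f" "rec_mset n X" "rec_fun n g"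
  shows "rec_pred n (\<lambda>e. in_seqs (f e) (X e) (g e))"
  unfolding in_seqs_def
  by (intro rec_intros assms rec_fun_shift[OF assms(1)] rec_fun_shift[OF assms(3)]
    rec_mset_shift[OF assms(2)]; simp)

text \<open>
  With \<open>y\<close> coding a list of sequents, \<open>left_ok\<close> and \<open>right_ok\<close> say that every rule instance with
  conclusion \<open>(mset_of l, c)\<close> and principal formula \<open>d\<close> or \<open>c\<close>, respectively (axioms included), has a
  premise in \<open>y\<close>. All quantifiers are bounded; \<open>X \<subseteq># Y\<close> is written as \<open>X - Y = {#}\<close>.
\<close>

definition left_ok :: "nat \<Rightarrow> nat \<Rightarrow> nat \<Rightarrow> nat \<Rightarrow> bool" where
  "left_ok y l c d \<longleftrightarrow> d \<noteq> prod_encode (1, 0) \<and>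
    (d = prod_encode (2, 0) \<longrightarrow> in_seqs y (mset_of l - {#d#}) c) \<and>
    (\<forall>a<d.
      (d = c_star a \<longrightarrow> (\<exists>k<y. in_seqs y (mset_of l - {#d#} + replicate_mset k a) c)) \<and>
      (\<forall>b<d.
        (d = c_bin 3 a b \<longrightarrow> (\<forall>p<Suc l. mset_of p - (mset_of l - {#d#}) = {#} \<longrightarrow>
          in_seqs y (mset_of p) a \<or> in_seqs y (mset_of l - {#d#} - mset_of p + {#b#}) c)) \<and>
        (d = c_bin 4 a b \<longrightarrow> in_seqs y (mset_of l - {#d#} + {#a#} + {#b#}) c) \<and>
        (d = c_bin 5 a b \<longrightarrow> in_seqs y (mset_of l - {#d#} + {#a#}) c \<or> in_seqs y (mset_of l - {#d#} + {#b#}) c) \<and>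
        (d = c_bin 6 a b \<longrightarrow> in_seqs y (mset_of l - {#d#} + {#a#}) c \<and> in_seqs y (mset_of l - {#d#} + {#b#}) c)))"

definition right_ok :: "nat \<Rightarrow> nat \<Rightarrow> nat \<Rightarrow> bool" where
  "right_ok y l c \<longleftrightarrow> mset_of l \<noteq> {#c#} \<and> (c = prod_encode (2, 0) \<longrightarrow> mset_of l \<noteq> {#}) \<and>
    (\<forall>a<c.
      (c = c_star a \<longrightarrow> mset_of l \<noteq> {#} \<and> (\<forall>p<Suc l. mset_of p \<noteq> {#} \<and> mset_of p - mset_of l = {#} \<longrightarrow>
        in_seqs y (mset_of p) a \<or> in_seqs y (mset_of l - mset_of p) c)) \<and>
      (\<forall>b<c.
        (c = c_bin 3 a b \<longrightarrow> in_seqs y (mset_of l + {#a#}) b) \<and>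
        (c = c_bin 4 a b \<longrightarrow> (\<forall>p<Suc l. mset_of p - mset_of l = {#} \<longrightarrow> in_seqs y (mset_of p) a \<or> in_seqs y (mset_of l - mset_of p) b)) \<and>
        (c = c_bin 5 a b \<longrightarrow> in_seqs y (mset_of l) a \<and> in_seqs y (mset_of l) b) \<and>
        (c = c_bin 6 a b \<longrightarrow> in_seqs y (mset_of l) a \<or> in_seqs y (mset_of l) b)))"

lemma rec_pred_left_ok: "rec_pred 4 (\<lambda>e. left_ok (e 0) (e 1) (e 2) (e 3))"
  unfolding left_ok_def by (intro rec_pred_in_seqs rec_intros; simp)

lemma rec_pred_right_ok: "rec_pred 3 (\<lambda>e. right_ok (e 0) (e 1) (e 2))"
  unfolding right_ok_def by (intro rec_pred_in_seqs rec_intros; simp)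

definition refutes :: "nat \<Rightarrow> bool" where
  "refutes y \<longleftrightarrow> (\<forall>e<y. e \<in> set (list_decode y) \<longrightarrow>
    right_ok y (fst (prod_decode e)) (snd (prod_decode e)) \<and>
    (\<forall>d<fst (prod_decode e). d \<in> set (list_decode (fst (prod_decode e))) \<longrightarrow>
      left_ok y (fst (prod_decode e)) (snd (prod_decode e)) d))"

text \<open>The condition on \<open>fst\<close> excludes the codes of all variables at once.\<close>

definition refutes_fm :: "nat \<Rightarrow> bool" where
  "refutes_fm y \<longleftrightarrow> (\<forall>d<y. d \<in> set (list_decode y) \<longrightarrow> fst (prod_decode d) \<noteq> 0 \<and>
    d \<noteq> prod_encode (1, 0) \<and> d \<noteq> prod_encode (2, 0) \<and>
    (\<forall>a<d. (d = c_star a \<longrightarrow> a \<in> set (list_decode y)) \<and>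
      (\<forall>b<d. d = c_bin 3 a b \<or> d = c_bin 4 a b \<or> d = c_bin 5 a b \<or> d = c_bin 6 a b \<longrightarrow>
        a \<in> set (list_decode y) \<or> b \<in> set (list_decode y))))"

lemma rec_pred_3:
  assumes "rec_pred 3 (\<lambda>e. P (e 0) (e 1) (e 2))" "rec_fun n f" "rec_fun n g" "rec_fun n h"
  shows "rec_pred n (\<lambda>e. P (f e) (g e) (h e))"
  using rec_fun_comp[of "[f, g, h]" "\<lambda>e. of_bool (P (e 0) (e 1) (e 2))" n] assms
  by (auto simp: rec_pred_def numeral_2_eq_2 numeral_3_eq_3)

lemma rec_pred_4:
  assumes "rec_pred 4 (\<lambda>e. P (e 0) (e 1) (e 2) (e 3))"
    "rec_fun n f" "rec_fun n g" "rec_fun n h" "rec_fun n k"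
  shows "rec_pred n (\<lambda>e. P (f e) (g e) (h e) (k e))"
  using rec_fun_comp[of "[f, g, h, k]" "\<lambda>e. of_bool (P (e 0) (e 1) (e 2) (e 3))" n] assms
  by (auto simp: rec_pred_def numeral_eq_Suc)

lemma rec_pred_refutes: "rec_fun n f \<Longrightarrow> rec_pred n (\<lambda>e. refutes (f e))"
  by (rule rec_pred_1[of refutes], unfold refutes_def)
    (intro rec_intros rec_pred_4[OF rec_pred_left_ok] rec_pred_3[OF rec_pred_right_ok]; simp)

lemma rec_pred_refutes_fm: "rec_fun n f \<Longrightarrow> rec_pred n (\<lambda>e. refutes_fm (f e))"
  by (rule rec_pred_1[of refutes_fm], unfold refutes_fm_def) (intro rec_intros; simp)

text \<open>The bounds in \<open>refutes_fm\<close> are harmless: members lie below the code of the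
  list, and components below the compound code.\<close>

lemma refutes_fm_iff: "refutes_fm y \<longleftrightarrow> refutation fm_rule (set (list_decode y))"
proof
  assume y: "refutes_fm y"
  show "refutation fm_rule (set (list_decode y))"
    unfolding refutation_def
  proof (intro ballI allI impI)
    fix d Ps
    assume d: "d \<in> set (list_decode y)" and "fm_rule d Ps"
    have "d < y" using elem_less_list_encode[OF d] by simp
    then have *: "fst (prod_decode d) \<noteq> 0" "d \<noteq> prod_encode (1, 0)" "d \<noteq> prod_encode (2, 0)"
      "\<And>a. a < d \<Longrightarrow> d = c_star a \<Longrightarrow> a \<in> set (list_decode y)"
      "\<And>a b. a < d \<Longrightarrow> b < d \<Longrightarrow> d = c_bin 3 a b \<or> d = c_bin 4 a b \<or> d = c_bin 5 a b \<or> d = c_bin 6 a b \<Longrightarrow>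
        a \<in> set (list_decode y) \<or> b \<in> set (list_decode y)"
      using y d unfolding refutes_fm_def by blast+
    from \<open>fm_rule d Ps\<close> show "\<exists>p\<in>Ps. p \<in> set (list_decode y)"
    proof cases
      case (4 t a b)
      then show ?thesis using *(5)[of a b] c_bin_less[of t a b] by auto
    next
      case (5 a)
      then show ?thesis using *(4)[of a] prod_encode_less[of 7 a] by auto
    qed (use *(1-3) in auto)
  qed
next
  assume y: "refutation fm_rule (set (list_decode y))"
  have "fst (prod_decode d) \<noteq> 0" if "d \<in> set (list_decode y)" for d
  proof
    assume "fst (prod_decode d) = 0"
    then have "d = prod_encode (0, snd (prod_decode d))"
      by (metis prod.collapse prod_decode_inverse)
    then show False
      using y that fm_rule.intros(1) unfolding refutation_def by (metis empty_iff)
  qed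
  then show "refutes_fm y"
    using y fm_rule.intros(2-) unfolding refutation_def refutes_fm_def by fast
qed

section \<open>Agreement of the recursive tests with refutations\<close>

definition seqs :: "nat \<Rightarrow> (nat multiset \<times> nat) set" where
  "seqs y = {(X, c). in_seqs y X c}"

lemma in_seqs_iff: "in_seqs y X c \<longleftrightarrow> (\<exists>e. e \<in> set (list_decode y) \<and> mset_of (fst (prod_decode e)) = X \<and> snd (prod_decode e) = c)"
proof -
  have "e < y" if "e \<in> set (list_decode y)" for e
    using elem_less_list_encode[OF that] by simp
  then show ?thesis unfolding in_seqs_def by blast
qed

text \<open>Justifies the bound on \<open>k\<close> in the star clause of \<open>left_ok\<close>:
  the size of an antecedent occurring in \<open>y\<close> is at most its code, which is below
  \<open>y\<close>.\<close>

lemma in_seqs_replicate_bound: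
  assumes "in_seqs y (X + replicate_mset k a) c"
  shows "k < y"
proof -
  obtain e where e: "e < y" "mset_of (fst (prod_decode e)) = X + replicate_mset k a"
    using assms by (auto simp: in_seqs_def)
  have "k \<le> size (mset_of (fst (prod_decode e)))"
    by (simp add: e(2))
  also have "\<dots> \<le> fst (prod_decode e)"
    using length_le_list_encode[of "list_decode (fst (prod_decode e))"] by simp
  also have "\<dots> \<le> e"
    using le_prod_encode_1[of "fst (prod_decode e)" "snd (prod_decode e)"] by simp
  finally show ?thesis using e(1) by simp
qed

lemma refutes_imp_refutation:
  assumes y: "refutes y"
  shows "refutation cf_rule (seqs y)"
  unfolding refutation_def
proof (intro ballI allI impI)
  fix s Ps
  assume "s \<in> seqs y" and inst: "cf_rule s Ps"
  then obtain e where e: "e < y" "e \<in> set (list_decode y)"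
    "s = (mset_of (fst (prod_decode e)), snd (prod_decode e))"
    by (auto simp: seqs_def in_seqs_def)
  define l c where "l = fst (prod_decode e)" and "c = snd (prod_decode e)"
  have R: "right_ok y l c" and "\<And>d. d < l \<Longrightarrow> d \<in> set (list_decode l) \<Longrightarrow> left_ok y l c d"
    using y e unfolding refutes_def l_def c_def by blast+
  then have L: "left_ok y l c d" if "d \<in># mset_of l" for d
    using that elem_less_list_encode[of d "list_decode l"] by simp
  \<comment> \<open>Supplies the bounded code \<open>p\<close> for the part split off in
    \<open>ImpL\<close>, \<open>ProdR\<close> and \<open>StarR1\<close>.\<close>
  have sub: "\<exists>p<Suc l. mset_of p = X" if "X \<subseteq># mset_of l" for X
    using submset_code[OF that] by (metis le_imp_less_Suc)
  from inst[unfolded e(3), folded l_def c_def] show "\<exists>p\<in>Ps. p \<in> seqs y"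
  proof cases
    case Ax
    then show ?thesis using R by (simp add: right_ok_def)
  next
    case (ZeroL G)
    then show ?thesis using L[of "prod_encode (1, 0)"] by (simp add: left_ok_def)
  next
    case OneR
    then show ?thesis using R by (simp add: right_ok_def)
  next
    case (OneL G)
    then show ?thesis using L[of "prod_encode (2, 0)"] by (simp add: left_ok_def seqs_def)
  next
    case (ImpL G P a b)
    then obtain p where "p < Suc l" "mset_of p = P" using sub[of P] by auto
    then show ?thesis
      using ImpL L[of "c_bin 3 a b"] c_bin_less[of 3 a b] by (auto simp: left_ok_def seqs_def)
  next
    case (ImpR a b)
    then show ?thesis using R c_bin_less[of 3 a b] by (auto simp: right_ok_def seqs_def)
  next
    case (ProdL G a b)
    then show ?thesis
      using L[of "c_bin 4 a b"] c_bin_less[of 4 a b] by (auto simp: left_ok_def seqs_def)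
  next
    case (ProdR G P a b)
    then obtain p where "p < Suc l" "mset_of p = G" using sub[of G] by auto
    then show ?thesis
      using ProdR R c_bin_less[of 4 a b] by (auto simp: right_ok_def seqs_def)
  next
    case (DisjL G a b)
    then show ?thesis
      using L[of "c_bin 5 a b"] c_bin_less[of 5 a b] by (auto simp: left_ok_def seqs_def)
  next
    case (DisjR1 a b)
    then show ?thesis using R c_bin_less[of 5 a b] by (auto simp: right_ok_def seqs_def)
  next
    case (DisjR2 a b)
    then show ?thesis using R c_bin_less[of 5 a b] by (auto simp: right_ok_def seqs_def)
  next
    case (ConjL1 G a b)
    then show ?thesis
      using L[of "c_bin 6 a b"] c_bin_less[of 6 a b] by (auto simp: left_ok_def seqs_def)
  next
    case (ConjL2 G a b)
    then show ?thesis
      using L[of "c_bin 6 a b"] c_bin_less[of 6 a b] by (auto simp: left_ok_def seqs_def)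
  next
    case (ConjR a b)
    then show ?thesis using R c_bin_less[of 6 a b] by (auto simp: right_ok_def seqs_def)
  next
    case (StarL G a)
    then show ?thesis
      using L[of "c_star a"] prod_encode_less[of 7 a] by (auto simp: left_ok_def seqs_def)
  next
    case (StarR0 a)
    then show ?thesis using R prod_encode_less[of 7 a] by (auto simp: right_ok_def)
  next
    case (StarR1 G P a)
    then obtain p where "p < Suc l" "mset_of p = G" using sub[of G] by auto
    then show ?thesis
      using StarR1 R prod_encode_less[of 7 a] by (auto simp: right_ok_def seqs_def)
  qed
qed

lemma refutation_imp_refutes:
  assumes y: "refutation cf_rule (seqs y)"
  shows "refutes y"
proof -
  have ref: "\<exists>(X, c)\<in>Ps. in_seqs y X c" if "in_seqs y X c" "cf_rule (X, c) Ps" for X c Ps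
    using y that unfolding refutation_def seqs_def by fastforce
  have left: "left_ok y l c d" if in_seqs: "in_seqs y (mset_of l) c" and "d \<in># mset_of l" for l c d
  proof -
    define G where "G = mset_of l - {#d#}"
    have ref': "\<exists>(X, c)\<in>Ps. in_seqs y X c" if "cf_rule (G + {#d#}, c) Ps" for Ps
      using ref[OF in_seqs] that \<open>d \<in># mset_of l\<close> by (simp add: G_def)
    \<comment> \<open>An axiom has no premises, so \<open>ref'\<close> at the empty set is a
      contradiction.\<close>
    have h1: "d \<noteq> prod_encode (1, 0)"
      using ref'[of "{}"] cf_rule.ZeroL[of G c] by auto
    have h2: "d = prod_encode (2, 0) \<Longrightarrow> in_seqs y G c"
      using ref'[of "{(G, c)}"] cf_rule.OneL[of G c] by auto
    have h3: "\<exists>k<y. in_seqs y (G + replicate_mset k a) c" if "d = c_star a" for a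
      using ref'[of "range (\<lambda>k. (G + replicate_mset k a, c))"] cf_rule.StarL[of G a c] that
        in_seqs_replicate_bound[of y G _ a c] by auto
    have h4: "in_seqs y P a \<or> in_seqs y (G - P + {#b#}) c" if "d = c_bin 3 a b" "P - G = {#}" for a b P
    proof -
      \<comment> \<open>The condition says that \<open>P\<close> is a submultiset of
        \<open>G\<close>, so truncated subtraction yields a genuine splitting of
        \<open>G\<close>.\<close>
      have "G - P + P = G"
        using that(2) by (simp add: Diff_eq_empty_iff_mset)
      then show ?thesis
        using ref'[of "{(P, a), (G - P + {#b#}, c)}"] cf_rule.ImpL[of "G - P" P a b c] that(1) by auto
    qed
    have h5: "d = c_bin 4 a b \<Longrightarrow> in_seqs y (G + {#a#} + {#b#}) c" for a b
      using ref'[of "{(G + {#a#} + {#b#}, c)}"] cf_rule.ProdL[of G a b c] by auto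
    have h6: "d = c_bin 5 a b \<Longrightarrow> in_seqs y (G + {#a#}) c \<or> in_seqs y (G + {#b#}) c" for a b
      using ref'[of "{(G + {#a#}, c), (G + {#b#}, c)}"] cf_rule.DisjL[of G a b c] by auto
    have h7: "d = c_bin 6 a b \<Longrightarrow> in_seqs y (G + {#a#}) c" "d = c_bin 6 a b \<Longrightarrow> in_seqs y (G + {#b#}) c" for a b
      using ref'[of "{(G + {#a#}, c)}"] ref'[of "{(G + {#b#}, c)}"] cf_rule.ConjL1[of G a b c]
        cf_rule.ConjL2[of G a b c] by auto
    show ?thesis
      unfolding left_ok_def G_def[symmetric]
      by (intro conjI allI impI; (elim conjE)?; rule h1 h2 h3 h4 h5 h6 h7; assumption)
  qed
  have right: "right_ok y l c" if in_seqs: "in_seqs y (mset_of l) c" for l c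
  proof -
    note ref' = ref[OF in_seqs]
    have h1: "mset_of l \<noteq> {#c#}"
      using ref'[of "{}"] cf_rule.Ax[of c] by auto
    have h2: "c = prod_encode (2, 0) \<Longrightarrow> mset_of l \<noteq> {#}"
      using ref'[of "{}"] cf_rule.OneR by auto
    have h3: "c = c_star a \<Longrightarrow> mset_of l \<noteq> {#}" for a
      using ref'[of "{}"] cf_rule.StarR0[of a] by auto
    have h4: "in_seqs y P a \<or> in_seqs y (mset_of l - P) c" if "c = c_star a" "P \<noteq> {#}" "P - mset_of l = {#}" for a P
    proof -
      have "P + (mset_of l - P) = mset_of l"
        using that(3) by (simp add: Diff_eq_empty_iff_mset)
      then show ?thesis
        using ref'[of "{(P, a), (mset_of l - P, c)}"] cf_rule.StarR1[of P "mset_of l - P" a] that by auto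
    qed
    have h5: "in_seqs y P a \<or> in_seqs y (mset_of l - P) b" if "c = c_bin 4 a b" "P - mset_of l = {#}" for a b P
    proof -
      have "P + (mset_of l - P) = mset_of l"
        using that(2) by (simp add: Diff_eq_empty_iff_mset)
      then show ?thesis
        using ref'[of "{(P, a), (mset_of l - P, b)}"] cf_rule.ProdR[of P "mset_of l - P" a b] that by auto
    qed
    have h6: "c = c_bin 3 a b \<Longrightarrow> in_seqs y (mset_of l + {#a#}) b" for a b
      using ref'[of "{(mset_of l + {#a#}, b)}"] cf_rule.ImpR[of "mset_of l" a b] by auto
    have h7: "c = c_bin 5 a b \<Longrightarrow> in_seqs y (mset_of l) a" "c = c_bin 5 a b \<Longrightarrow> in_seqs y (mset_of l) b" for a b
      using ref'[of "{(mset_of l, a)}"] ref'[of "{(mset_of l, b)}"] cf_rule.DisjR1[of "mset_of l" a b]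
        cf_rule.DisjR2[of "mset_of l" a b] by auto
    have h8: "c = c_bin 6 a b \<Longrightarrow> in_seqs y (mset_of l) a \<or> in_seqs y (mset_of l) b" for a b
      using ref'[of "{(mset_of l, a), (mset_of l, b)}"] cf_rule.ConjR[of "mset_of l" a b] by auto
    show ?thesis
      unfolding right_ok_def
      by (intro conjI allI impI; (elim conjE)?; rule h1 h2 h3 h4 h5 h6 h7 h8; assumption)
  qed
  show "refutes y"
    unfolding refutes_def
  proof (intro allI impI conjI)
    fix e assume "e < y" "e \<in> set (list_decode y)"
    then have in_seqs: "in_seqs y (mset_of (fst (prod_decode e))) (snd (prod_decode e))"
      unfolding in_seqs_def by blast
    then show "right_ok y (fst (prod_decode e)) (snd (prod_decode e))"
      by (rule right)
    fix d assume "d \<in> set (list_decode (fst (prod_decode e)))"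
    then show "left_ok y (fst (prod_decode e)) (snd (prod_decode e)) d"
      using left[OF in_seqs, of d] by simp
  qed
qed

lemma refutes_iff: "refutes y \<longleftrightarrow> refutation cf_rule (seqs y)"
  using refutes_imp_refutation refutation_imp_refutes by blast

section \<open>Numerical witnesses of underivability and the universal definition\<close>

lemma lists_range_imp_map:
  assumes "set xs \<subseteq> range f"
  shows "\<exists>ys. xs = map f ys"
proof -
  have "xs \<in> lists (range f)"
    using assms by auto
  then have "xs \<in> map f ` lists UNIV"
    by (simp only: lists_image)
  then show ?thesis by blast
qed

text \<open>The two disjuncts are the two ways to fail beyond an unsorted antecedent: some number in
  \<open>x\<close> is no formula code, or the sequent has no cut-free derivation.\<close>

definition witness :: "nat \<Rightarrow> nat \<Rightarrow> bool" where
  "witness x y \<longleftrightarrow>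
    refutes_fm y \<and> (\<exists>d<Suc x. (d \<in> set (list_decode (fst (prod_decode x))) \<or> d = snd (prod_decode x)) \<and>
      d \<in> set (list_decode y)) \<or>
    refutes y \<and> in_seqs y (mset_of (fst (prod_decode x))) (snd (prod_decode x))"

lemma ex_fm_witness_iff:
  "(\<exists>y. refutes_fm y \<and> d \<in> set (list_decode y)) \<longleftrightarrow> d \<notin> range fm_code"
proof
  assume "\<exists>y. refutes_fm y \<and> d \<in> set (list_decode y)"
  then obtain y where "refutation fm_rule (set (list_decode y))" "d \<in> set (list_decode y)"
    unfolding refutes_fm_iff by blast
  then have "\<not> deriv fm_rule d"
    using refutation_not_deriv[of fm_rule "set (list_decode y)" d] by blast
  then show "d \<notin> range fm_code"
    by (simp only: deriv_fm_rule_iff not_False_eq_True)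
next
  assume "d \<notin> range fm_code"
  then obtain F where F: "finite F" "d \<in> F" "refutation fm_rule F"
    using fm_refutation by blast
  show "\<exists>y. refutes_fm y \<and> d \<in> set (list_decode y)"
    by (rule exI[of _ "list_encode (sorted_list_of_set F)"]) (simp add: refutes_fm_iff F)
qed

text \<open>Turns the finite refutations obtained by well-foundedness into numbers over which the
  matrix of the universal definition can quantify.\<close>

lemma ex_seqs:
  assumes "finite F"
  shows "\<exists>y. seqs y = F"
proof -
  define code where "code = (\<lambda>s. prod_encode (list_encode (sorted_list_of_multiset (fst s)), snd s) :: nat)"
  obtain xs where xs: "set xs = F"
    using finite_list[OF assms] by blast
  have code: "(mset_of (fst (prod_decode (code s))), snd (prod_decode (code s))) = s" for s
    by (simp add: code_def)
  have "seqs (list_encode (map code xs)) =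
      (\<lambda>e. (mset_of (fst (prod_decode e)), snd (prod_decode e))) ` set (map code xs)"
    by (auto simp: seqs_def in_seqs_iff)
  also have "\<dots> = F"
    by (simp add: image_image code xs)
  finally show ?thesis by blast
qed

lemma ex_witness_iff: "(\<exists>y. refutes y \<and> in_seqs y X c) \<longleftrightarrow> \<not> cf X c"
proof
  assume "\<exists>y. refutes y \<and> in_seqs y X c"
  then obtain y where "refutation cf_rule (seqs y)" "(X, c) \<in> seqs y"
    by (auto simp: refutes_iff seqs_def)
  then show "\<not> cf X c"
    using refutation_not_deriv[of cf_rule "seqs y" "(X, c)"] by blast
next
  assume "\<not> cf X c"
  then obtain F where F: "finite F" "(X, c) \<in> F" "refutation cf_rule F"
    using cf_refutation by blast
  then obtain y where "seqs y = F" using ex_seqs by blast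
  then show "\<exists>y. refutes y \<and> in_seqs y X c"
    using F by (auto simp: refutes_iff seqs_def)
qed

lemma ex_witness:
  "(\<exists>y. witness x y) \<longleftrightarrow> \<not> set (list_decode (fst (prod_decode x))) \<subseteq> range fm_code \<or>
    snd (prod_decode x) \<notin> range fm_code \<or> \<not> cf (mset_of (fst (prod_decode x))) (snd (prod_decode x))"
proof -
  let ?l = "fst (prod_decode x)" and ?c = "snd (prod_decode x)"
  have lc: "?l \<le> x" "?c \<le> x"
    using le_prod_encode_1[of ?l ?c] le_prod_encode_2[of ?c ?l] by auto
  have "d < Suc x" if "d \<in> set (list_decode ?l) \<or> d = ?c" for d
    using that lc elem_less_list_encode[of d "list_decode ?l"] by auto
  then have "(\<exists>y. witness x y) \<longleftrightarrow> (\<exists>d. (d \<in> set (list_decode ?l) \<or> d = ?c) \<and>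
      (\<exists>y. refutes_fm y \<and> d \<in> set (list_decode y))) \<or> (\<exists>y. refutes y \<and> in_seqs y (mset_of ?l) ?c)"
    unfolding witness_def by blast
  then show ?thesis
    unfolding ex_fm_witness_iff ex_witness_iff by blast
qed

theorem theorem5: "{sequent_code (\<Gamma>, C) | \<Gamma> C. \<Gamma> \<turnstile> C} \<in> Pi01"
proof -
  \<comment> \<open>Sortedness selects the one canonical code of each sequent; it is decidable and
    needs no witness.\<close>
  define R where "R x y \<longleftrightarrow> sorted (list_decode (fst (prod_decode x))) \<and> \<not> witness x y" for x y
  have "rec_pred 2 (\<lambda>e. R (e 0) (e 1))"
    unfolding R_def witness_def
    by (intro rec_intros rec_pred_in_seqs rec_pred_refutes rec_pred_refutes_fm; simp)
  then have "recursive_rel2 R"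
    by (simp add: rec_pred_def rec_fun_def recursive_rel2_def of_bool_def)
  moreover have "(\<exists>\<Gamma> C. x = sequent_code (\<Gamma>, C) \<and> \<Gamma> \<turnstile> C) \<longleftrightarrow> (\<forall>y. R x y)" for x
  proof
    assume "\<exists>\<Gamma> C. x = sequent_code (\<Gamma>, C) \<and> \<Gamma> \<turnstile> C"
    then obtain \<Gamma> C where "x = sequent_code (\<Gamma>, C)" "\<Gamma> \<turnstile> C" by blast
    then show "\<forall>y. R x y"
      using derivable_imp_cf[of \<Gamma> C] ex_witness[of x] by (auto simp: R_def sequent_code_def)
  next
    assume R: "\<forall>y. R x y"
    let ?l = "fst (prod_decode x)" and ?c = "snd (prod_decode x)"
    have *: "sorted (list_decode ?l)" "set (list_decode ?l) \<subseteq> range fm_code" "?c \<in> range fm_code"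
      "cf (mset_of ?l) ?c"
      using R ex_witness[of x] unfolding R_def by blast+
    then obtain As C where As: "list_decode ?l = map fm_code As" and C: "?c = fm_code C"
      using lists_range_imp_map by blast
    then have "mset As \<turnstile> C"
      using cf_imp_derivable[OF *(4)] by simp
    \<comment> \<open>Here sortedness is used: sorting the rebuilt antecedent returns the given
      list, so \<open>x\<close> is the code of the decoded sequent.\<close>
    moreover have "list_encode (sorted_list_of_multiset (image_mset fm_code (mset As))) = ?l"
      using As *(1) by (metis list_decode_inverse mset_map sorted_list_of_multiset_mset sorted_sort_id)
    then have "sequent_code (mset As, C) = x"
      using C by (simp add: sequent_code_def) (metis prod.collapse prod_decode_inverse)
    ultimately show "\<exists>\<Gamma> C. x = sequent_code (\<Gamma>, C) \<and> \<Gamma> \<turnstile> C" by blast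
  qed
  then have "{sequent_code (\<Gamma>, C) | \<Gamma> C. \<Gamma> \<turnstile> C} = {x. \<forall>y. R x y}" by blast
  ultimately show ?thesis unfolding Pi01_def by blast
qed

end
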